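(* Let $d\ge3$ and consider a $d$-dimensional random walk with internal states satisfying the basic assumptions (i)–(iv). Then the strong law of large numbers holds for the number of visited sites: $$P\left(\lim_{n\to\infty}\frac{L_d(n)}{E_d(n)}=1\right)=1.$$
   Context: Random walk with internal states (RWwIS). $E=\{1,\dots,s\}$ is a finite set, $d\ge1$, and $p_{y,j,k}\ge 0$ ($y\in\mathbb{Z}^d$, $j,k\in E$) satisfy $\sum_{y,k}p_{y,j,k}=1$ for each $j$. The RWwIS is the Markov chain $\xi_n=(\eta_n,\varepsilon_n)$ on $\mathbb{Z}^d\times E$ with $P(\xi_{n+1}=(x',k)\mid \xi_n=(x,j))=p_{x'-x,j,k}$; we start from $\eta_0=0$, the distribution of $\varepsilon_0$ being arbitrary. Put $A_y=(p_{y,j,k})_{j,k}$, $Q=\sum_y A_y$, $M_l=\sum_y y_lA_y$, $\Sigma_{l,m}=\sum_y y_ly_mA_y$, $\underline{1}=(1,\dots,1)^T\in\mathbb{R}^s$. Basic assumptions: (i) the Markov chain $(\varepsilon_n)$ on $E$, whose transition matrix is $Q$, is irreducible and aperiodic; $\mu$ is its unique stationary distribution. (ii) Trivial arithmetic: for $j\in E$ the subgroup of $\mathbb{Z}^d$ generated by all differences $y-y'$ such that for some $n\geq 1$ both $P(\xi_n=(y,j)\mid\xi_0=(0,j))>0$ and $P(\xi_n=(y',j)\mid\xi_0=(0,j))>0$ is $\mathbb{Z}^d$. (iii) Zero mean: $\langle\mu,M_l\underline{1}\rangle=0$ for all $l$. (iv) The second moments $\sum_y\|y\|^2A_y$ converge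 and the covariance matrix $\sigma=(\sigma_{l,m})_{1\le l,m\le d}$, $\sigma_{l,m}=\langle\mu,\Sigma_{l,m}\underline{1}\rangle-\langle\mu,M_l(Q-1)^{-1}M_m\underline{1}\rangle-\langle\mu,M_m(Q-1)^{-1}M_l\underline{1}\rangle$, is nonsingular (positive definite); here $(Q-1)^{-1}M_m\underline{1}$ is the unique vector $v$ with $\langle\mu,v\rangle=0$ and $Qv-v=M_m\underline{1}$. $L_d(n)=\#\{\eta_0,\dots,\eta_n\}$ is the number of distinct sites visited up to $n$ steps, and $E_d(n)$ is its expectation. *)

theory Defs
  imports
    "HOL-Probability.Probability"
    "HOL-Computational_Algebra.Group_Closure"
begin

text \<open>
  The lattice $\mathbb{Z}^d$ is the type \<open>int ^ 'd\<close> with $d$ = \<open>CARD('d)\<close>, and the set of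
  internal states is a finite type \<open>'s\<close>. The weight $p_{y,j,k}$ is written \<open>p y j k\<close>.
\<close>

type_synonym ('d, 's) weights = "int ^ 'd \<Rightarrow> 's \<Rightarrow> 's \<Rightarrow> real"

definition rw_weights :: "('d::finite, 's::finite) weights \<Rightarrow> bool" where
  "rw_weights p \<longleftrightarrow>
     (\<forall>y j k. 0 \<le> p y j k) \<and> (\<forall>j. ((\<lambda>(y, k). p y j k) has_sum 1) UNIV)"

text \<open>
  The Markov property and the transition probabilities are expressed together, by conditioning on
  the whole past trajectory. The law of the initial internal state \<open>\<epsilon> 0\<close> is unconstrained.
\<close>

locale rwwis = prob_space M
  for M :: "'w measure"
    and p :: "('d::finite, 's::finite) weights"
    and \<eta> :: "nat \<Rightarrow> 'w \<Rightarrow> int ^ 'd"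
    and \<epsilon> :: "nat \<Rightarrow> 'w \<Rightarrow> 's" +
  assumes weights: "rw_weights p"
    and measurable_position: "\<And>n. \<eta> n \<in> measurable M (count_space UNIV)"
    and measurable_state: "\<And>n. \<epsilon> n \<in> measurable M (count_space UNIV)"
    and start: "AE \<omega> in M. \<eta> 0 \<omega> = 0"
    and markov: "\<And>n x e. \<P>(\<omega> in M. \<forall>i\<le>n. \<eta> i \<omega> = x i \<and> \<epsilon> i \<omega> = e i) > 0 \<Longrightarrow>
      \<P>(\<omega> in M. \<eta> (Suc n) \<omega> = x (Suc n) \<and> \<epsilon> (Suc n) \<omega> = e (Suc n)
          \<bar> \<forall>i\<le>n. \<eta> i \<omega> = x i \<and> \<epsilon> i \<omega> = e i)
        = p (x (Suc n) - x n) (e n) (e (Suc n))"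

definition rw_A :: "('d::finite, 's::finite) weights \<Rightarrow> int ^ 'd \<Rightarrow> real ^ 's ^ 's" where
  "rw_A p y = (\<chi> j k. p y j k)"

definition rw_Q :: "('d::finite, 's::finite) weights \<Rightarrow> real ^ 's ^ 's" where
  "rw_Q p = (\<Sum>\<^sub>\<infinity>y. rw_A p y)"

definition rw_M :: "('d::finite, 's::finite) weights \<Rightarrow> 'd \<Rightarrow> real ^ 's ^ 's" where
  "rw_M p l = (\<Sum>\<^sub>\<infinity>y. real_of_int (y $ l) *\<^sub>R rw_A p y)"

definition rw_Sigma :: "('d::finite, 's::finite) weights \<Rightarrow> 'd \<Rightarrow> 'd \<Rightarrow> real ^ 's ^ 's" where
  "rw_Sigma p l m = (\<Sum>\<^sub>\<infinity>y. real_of_int (y $ l * y $ m) *\<^sub>R rw_A p y)"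

definition ones :: "real ^ 's::finite" where
  "ones = (\<chi> j. 1)"

text \<open>On \<open>real ^ 's ^ 's\<close> the operation \<open>^\<close> is the componentwise power, hence this definition.\<close>

definition mat_power :: "real ^ 's ^ 's \<Rightarrow> nat \<Rightarrow> real ^ 's ^ 's::finite" where
  "mat_power P n = (((**) P) ^^ n) (mat 1)"

definition irreducible_matrix :: "real ^ 's ^ 's::finite \<Rightarrow> bool" where
  "irreducible_matrix P \<longleftrightarrow> (\<forall>j k. \<exists>n. 0 < mat_power P n $ j $ k)"

definition aperiodic_matrix :: "real ^ 's ^ 's::finite \<Rightarrow> bool" where
  "aperiodic_matrix P \<longleftrightarrow> (\<forall>j. Gcd {n. 1 \<le> n \<and> 0 < mat_power P n $ j $ j} = 1)"

definition stationary_distribution :: "real ^ 's ^ 's \<Rightarrow> real ^ 's::finite \<Rightarrow> bool" where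
  "stationary_distribution P \<mu> \<longleftrightarrow>
     (\<forall>j. 0 \<le> \<mu> $ j) \<and> (\<Sum>j\<in>UNIV. \<mu> $ j) = 1 \<and> \<mu> v* P = \<mu>"

text \<open>
  \<open>rw_step p n y j k\<close> is the $n$-step transition probability
  $P(\xi_n = (y, k) \mid \xi_0 = (0, j))$ of the kernel. It is defined from \<open>p\<close> because the event
  $\xi_0 = (0, j)$ may have probability zero under the actual initial law.
\<close>

fun rw_step :: "('d::finite, 's::finite) weights \<Rightarrow> nat \<Rightarrow> ('d, 's) weights" where
  "rw_step p 0 y j k = (if y = 0 \<and> j = k then 1 else 0)"
| "rw_step p (Suc n) y j k = (\<Sum>\<^sub>\<infinity>(z, i). rw_step p n z j i * p (y - z) i k)"

definition trivial_arithmetic :: "('d::finite, 's::finite) weights \<Rightarrow> bool" where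
  "trivial_arithmetic p \<longleftrightarrow>
     (\<forall>j. group_closure {y - y' | y y'. \<exists>n\<ge>1. 0 < rw_step p n y j j \<and> 0 < rw_step p n y' j j}
          = UNIV)"

definition zero_mean :: "('d::finite, 's::finite) weights \<Rightarrow> real ^ 's \<Rightarrow> bool" where
  "zero_mean p \<mu> \<longleftrightarrow> (\<forall>l. \<mu> \<bullet> (rw_M p l *v ones) = 0)"

text \<open>The Euclidean norm is taken in \<open>real ^ 'd\<close>, as \<open>int ^ 'd\<close> carries none.\<close>

definition second_moments_converge :: "('d::finite, 's::finite) weights \<Rightarrow> bool" where
  "second_moments_converge p \<longleftrightarrow>
     (\<lambda>y. (norm (\<chi> l. real_of_int (y $ l)))\<^sup>2 *\<^sub>R rw_A p y) summable_on UNIV"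

text \<open>The vector $(Q-1)^{-1} M_m \underline{1}$.\<close>

definition rw_corrector :: "('d::finite, 's::finite) weights \<Rightarrow> real ^ 's \<Rightarrow> 'd \<Rightarrow> real ^ 's" where
  "rw_corrector p \<mu> m = (THE v. \<mu> \<bullet> v = 0 \<and> rw_Q p *v v - v = rw_M p m *v ones)"

definition rw_covariance :: "('d::finite, 's::finite) weights \<Rightarrow> real ^ 's \<Rightarrow> real ^ 'd ^ 'd" where
  "rw_covariance p \<mu> = (\<chi> l m.
     \<mu> \<bullet> (rw_Sigma p l m *v ones)
     - \<mu> \<bullet> (rw_M p l *v rw_corrector p \<mu> m)
     - \<mu> \<bullet> (rw_M p m *v rw_corrector p \<mu> l))"

definition basic_assumptions :: "('d::finite, 's::finite) weights \<Rightarrow> real ^ 's \<Rightarrow> bool" where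
  "basic_assumptions p \<mu> \<longleftrightarrow>
     irreducible_matrix (rw_Q p) \<and> aperiodic_matrix (rw_Q p) \<and>
     stationary_distribution (rw_Q p) \<mu> \<and>
     trivial_arithmetic p \<and>
     zero_mean p \<mu> \<and>
     second_moments_converge p \<and>
     invertible (rw_covariance p \<mu>) \<and>
     (\<forall>u. u \<noteq> 0 \<longrightarrow> 0 < u \<bullet> (rw_covariance p \<mu> *v u))"

definition visited_sites :: "(nat \<Rightarrow> 'w \<Rightarrow> 'x) \<Rightarrow> nat \<Rightarrow> 'w \<Rightarrow> nat" where
  "visited_sites \<eta> n \<omega> = card ((\<lambda>i. \<eta> i \<omega>) ` {0..n})"

definition expected_visited_sites :: "'w measure \<Rightarrow> (nat \<Rightarrow> 'w \<Rightarrow> 'x) \<Rightarrow> nat \<Rightarrow> real" where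
  "expected_visited_sites M \<eta> n = (LINT \<omega>|M. real (visited_sites \<eta> n \<omega>))"

end

theory Submission
  imports Defs
begin

text \<open>
  The number \<open>L n\<close> of sites visited up to time \<open>n\<close> grows linearly in mean and fluctuates on a smaller
  scale. Two properties of the kernel are responsible for this.

  First, a return after \<open>n\<close> steps has probability \<open>O(n powr (-3/2))\<close>, uniformly in the initial
  internal state (\<open>return_probability_decay\<close>). By Fourier inversion this probability is the average
  over the torus of the transition operator twisted by the character of parameter \<open>\<theta>\<close>. When two
  paths of equal length lead from \<open>j\<close> back to \<open>j\<close> with displacements \<open>y\<close> and \<open>y'\<close>, their
  contributions to the twisted operator interfere, which produces a loss of order
  \<open>(sin (\<theta> \<bullet> (y - y') / 2))\<^sup>2\<close>. By trivial arithmetic such differences generate the lattice, so over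
  a fixed number of steps the operator contracts the sup norm by \<open>exp (- c |\<theta>|\<^sup>2)\<close>. Over \<open>n\<close> steps
  the contraction is Gaussian in \<open>\<theta>\<close> and its integral over the torus is \<open>O(n powr (-d/2))\<close>.

  Secondly, the internal states forget their past at an exponential rate, by irreducibility and
  aperiodicity (\<open>summable_mixing_rate\<close>).

  Let \<open>E n\<close> be the mean of \<open>L n\<close>. Since \<open>\<Sum> t powr (-3/2)\<close> converges, the expected number of pairs
  of times at which the walk is at the same site is \<open>O(n)\<close>, and a second moment argument gives
  \<open>E n \<ge> c * n\<close> (\<open>expect_sites_ge\<close>). For the fluctuations, each site is counted at its last visit:
  \<open>L n\<close> is the number of times \<open>i \<le> n\<close> after which the walk does not come back to its current site by
  time \<open>n\<close>. If only the returns within \<open>m\<close> steps are considered, the mean error is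
  \<open>O(n / sqrt m)\<close>, by the decay of the return probability; the truncated indicators depend on windows
  of length \<open>m\<close>, so by mixing their sum has variance \<open>O(n * m)\<close>. With \<open>m = sqrt n\<close> the mean
  absolute deviation of \<open>L n\<close> is \<open>O(n powr (3/4))\<close>.

  Along \<open>n = k ^ 8\<close> the mean of \<open>|L n - E n| / n\<close> is thus \<open>O(1 / k\<^sup>2)\<close>, which is summable, and
  \<open>(L n - E n) / n\<close> tends to \<open>0\<close> almost surely along this sequence. The remaining \<open>n\<close> are reached
  by monotonicity (\<open>ratio_tends_to_1_from_eighth_powers\<close>), because consecutive eighth powers have
  ratio tending to \<open>1\<close>.
\<close>

section \<open>Paths and twisted transition operators\<close>

text \<open>
  A trajectory is recorded as the list of its steps, each consisting of an increment and the internal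
  state that follows it. In these coordinates the kernel depends only on the current internal state,
  so the invariance under translations is built in.
\<close>

fun path_pmf :: "('s \<Rightarrow> ('g \<times> 's) pmf) \<Rightarrow> nat \<Rightarrow> 's \<Rightarrow> ('g \<times> 's) list pmf" where
  "path_pmf K 0 j = return_pmf []"
| "path_pmf K (Suc n) j = bind_pmf (K j) (\<lambda>z. map_pmf ((#) z) (path_pmf K n (snd z)))"

fun final_state :: "'s \<Rightarrow> ('g \<times> 's) list \<Rightarrow> 's" where
  "final_state j [] = j"
| "final_state j (z # l) = final_state (snd z) l"

definition displacement :: "('g::ab_group_add \<times> 's) list \<Rightarrow> 'g" where
  "displacement l = sum_list (map fst l)"

lemma displacement_simps [simp]:
  "displacement [] = 0"
  "displacement (z # l) = fst z + displacement l"
  "displacement (l @ l') = displacement l + displacement l'"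
  by (simp_all add: displacement_def)

lemma final_state_append [simp]: "final_state j (l @ l') = final_state (final_state j l) l'"
  by (induction l arbitrary: j) auto

lemma length_path: "l \<in> set_pmf (path_pmf K n j) \<Longrightarrow> length l = n"
  by (induction n arbitrary: j l) auto

text \<open>
  The Markov property: after \<open>a\<close> steps the path restarts from its current internal state.
\<close>

lemma path_pmf_add:
  fixes K :: "'s \<Rightarrow> ('g \<times> 's) pmf"
  shows "path_pmf K (a + b) j =
     bind_pmf (path_pmf K a j) (\<lambda>l. map_pmf ((@) l) (path_pmf K b (final_state j l)))"
proof (induction a arbitrary: j)
  case 0
  show ?case by (simp add: bind_return_pmf pmf.map_ident_strong)
next
  case (Suc a)
  have *: "(#) z \<circ> (@) l = (@) (z # l)" for z :: "'g \<times> 's" and l by auto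
  show ?case
    by (simp add: Suc.IH bind_assoc_pmf bind_map_pmf map_bind_pmf pmf.map_comp *)
qed

lemma path_append_in_support:
  assumes "l \<in> set_pmf (path_pmf K a j)" "l' \<in> set_pmf (path_pmf K b (final_state j l))"
  shows "l @ l' \<in> set_pmf (path_pmf K (a + b) j)"
  using assms by (auto simp: path_pmf_add)

lemma expectation_bind_pmf:
  fixes f :: "'b \<Rightarrow> real"
  assumes "\<And>x. \<bar>f x\<bar> \<le> B"
  shows "measure_pmf.expectation (bind_pmf p k) f
       = measure_pmf.expectation p (\<lambda>x. measure_pmf.expectation (k x) f)"
  unfolding measure_pmf_bind
  by (rule integral_bind[where K = "count_space UNIV" and B = B and B' = 1])
     (use assms in \<open>auto simp: space_subprob_algebra measure_pmf.subprob_space_axioms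
        measure_pmf.emeasure_space_1 measure_pmf.finite_measure_axioms intro!: measurable_pmf_measure2\<close>)

lemma integrable_pmf_bounded:
  fixes f :: "'b \<Rightarrow> 'c::{banach, second_countable_topology}"
  assumes "\<And>x. norm (f x) \<le> B"
  shows "integrable (measure_pmf p) f"
  using assms by (intro measure_pmf.integrable_const_bound[where B = B]) auto

lemma norm_expectation_pmf_le:
  fixes f :: "'b \<Rightarrow> 'c::{banach, second_countable_topology}"
  assumes "\<And>x. norm (f x) \<le> B"
  shows "norm (measure_pmf.expectation p f) \<le> B"
proof -
  have "norm (measure_pmf.expectation p f) \<le> measure_pmf.expectation p (\<lambda>x. norm (f x))"
    by (rule integral_norm_bound)
  also have "\<dots> \<le> measure_pmf.expectation p (\<lambda>x. B)"
    using assms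
    by (intro integral_mono integrable_norm integrable_pmf_bounded[where B = B] measure_pmf.integrable_const) auto
  also have "\<dots> = B" by simp
  finally show ?thesis .
qed

lemma complex_expectation_bind_pmf:
  fixes f :: "'b \<Rightarrow> complex"
  assumes f: "\<And>x. norm (f x) \<le> B"
  shows "measure_pmf.expectation (bind_pmf p k) f
       = measure_pmf.expectation p (\<lambda>x. measure_pmf.expectation (k x) f)"
proof -
  note i = integrable_pmf_bounded[where f = f, OF f]
  have i2: "integrable (measure_pmf p) (\<lambda>x. measure_pmf.expectation (k x) f)"
    by (rule integrable_pmf_bounded[where B = B]) (rule norm_expectation_pmf_le[OF f])
  have "\<bar>Re (f x)\<bar> \<le> B" "\<bar>Im (f x)\<bar> \<le> B" for x
    using f[of x] abs_Re_le_cmod[of "f x"] abs_Im_le_cmod[of "f x"] by linarith+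
  then show ?thesis
    using expectation_bind_pmf[of "\<lambda>x. Re (f x)" B p k] expectation_bind_pmf[of "\<lambda>x. Im (f x)" B p k]
    by (simp add: complex_eq_iff i i2)
qed

text \<open>
  For an additive \<open>h\<close> this is the \<open>n\<close>-th power of the matrix \<open>\<Sum>y. exp (i h(y)) A\<^sub>y\<close>, applied to the
  vector \<open>f\<close>; as a function of \<open>h\<close> it is the Fourier transform of the law of \<open>n\<close> steps.
\<close>

definition twisted ::
  "('s \<Rightarrow> ('g::ab_group_add \<times> 's) pmf) \<Rightarrow> ('g \<Rightarrow> real) \<Rightarrow> nat \<Rightarrow> ('s \<Rightarrow> complex) \<Rightarrow> 's \<Rightarrow> complex"
  where
  "twisted K h n f j = measure_pmf.expectation (path_pmf K n j)
     (\<lambda>l. cis (h (displacement l)) * f (final_state j l))"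

lemma norm_twisted_le:
  assumes "\<And>i. norm (f i) \<le> B"
  shows "norm (twisted K h n f j) \<le> B"
  unfolding twisted_def by (rule norm_expectation_pmf_le) (simp add: norm_mult assms)

lemma twisted_add:
  fixes f :: "'s::finite \<Rightarrow> complex"
  assumes h: "\<And>x y. h (x + y) = h x + h y"
  shows "twisted K h (a + b) f j = twisted K h a (twisted K h b f) j"
proof -
  define B where "B = Max (range (\<lambda>i. norm (f i)))"
  have B: "norm (f i) \<le> B" for i unfolding B_def by (rule Max_ge) auto
  have "twisted K h (a + b) f j = measure_pmf.expectation (path_pmf K a j) (\<lambda>l.
      measure_pmf.expectation (path_pmf K b (final_state j l)) (\<lambda>l'.
        cis (h (displacement l)) * (cis (h (displacement l')) * f (final_state (final_state j l) l'))))"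
    unfolding twisted_def path_pmf_add
    by (subst complex_expectation_bind_pmf[where B = B])
       (auto simp: norm_mult B h cis_mult[symmetric] mult.assoc)
  also have "\<dots> = twisted K h a (twisted K h b f) j"
    unfolding twisted_def by (intro Bochner_Integration.integral_cong refl) simp
  finally show ?thesis .
qed

text \<open>
  For equal weights the sum of two phases has modulus \<open>2 |cos ((a - b) / 2)|\<close>; the part of the
  larger weight that exceeds the smaller one is estimated trivially.
\<close>

lemma norm_two_phases_le:
  fixes a b u v :: real
  assumes "0 \<le> u" "0 \<le> v"
  shows "norm (u *\<^sub>R cis a + v *\<^sub>R cis b) \<le> u + v - min u v * (sin ((a - b) / 2))\<^sup>2"
proof -
  have half: "norm (cis a + cis b) = 2 * \<bar>cos ((a - b) / 2)\<bar>" for a b :: real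
  proof -
    have "cis a + cis b = cis ((a + b) / 2) * (cis ((a - b) / 2) + cis (- ((a - b) / 2)))"
      unfolding distrib_left cis_mult by (intro arg_cong2[where f = "(+)"] arg_cong[where f = cis]) (auto simp: field_simps)
    also have "cis ((a - b) / 2) + cis (- ((a - b) / 2)) = of_real (2 * cos ((a - b) / 2))"
      by (simp add: complex_eq_iff)
    finally show ?thesis by (simp add: norm_mult)
  qed
  \<comment> \<open>equivalent to \<open>0 \<le> (1 - |cos x|)\<^sup>2\<close>\<close>
  have cos_le: "2 * \<bar>cos x\<bar> \<le> 2 - (sin x)\<^sup>2" for x :: real
  proof -
    have "0 \<le> (1 - \<bar>cos x\<bar>)\<^sup>2" by simp
    then show ?thesis by (simp add: power2_diff sin_squared_eq)
  qed
  have main: "norm (u *\<^sub>R cis a + v *\<^sub>R cis b) \<le> u + v - u * (sin ((a - b) / 2))\<^sup>2"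
    if "0 \<le> u" "u \<le> v" for u v a b :: real
  proof -
    have "u *\<^sub>R cis a + v *\<^sub>R cis b = u *\<^sub>R (cis a + cis b) + (v - u) *\<^sub>R cis b"
      by (simp add: algebra_simps)
    then have "norm (u *\<^sub>R cis a + v *\<^sub>R cis b) \<le> norm (u *\<^sub>R (cis a + cis b)) + norm ((v - u) *\<^sub>R cis b)"
      using norm_triangle_ineq by metis
    also have "\<dots> = u * (2 * \<bar>cos ((a - b) / 2)\<bar>) + (v - u)"
      using that by (simp only: norm_scaleR half norm_cis) simp
    also have "\<dots> \<le> u * (2 - (sin ((a - b) / 2))\<^sup>2) + (v - u)"
      using cos_le that by (intro add_mono mult_left_mono) auto
    finally show ?thesis by (simp add: algebra_simps)
  qed
  show ?thesis
  proof (cases "u \<le> v")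
    case True
    then show ?thesis using main[of u v a b] assms by simp
  next
    case False
    have "(sin ((b - a) / 2))\<^sup>2 = (sin ((a - b) / 2))\<^sup>2"
      by (metis minus_diff_eq minus_divide_left power2_minus sin_minus)
    then show ?thesis using main[of v u b a] assms False by (simp add: add.commute)
  qed
qed

text \<open>
  Both paths end in the same state, so \<open>f\<close> takes the same value on them and their two phases
  interfere. All the other paths are estimated by their total mass.
\<close>

lemma norm_twisted_two_paths_le:
  assumes l: "l \<in> set_pmf (path_pmf K n j)" "l' \<in> set_pmf (path_pmf K n j)"
    and same: "final_state j l = final_state j l'"
    and f: "\<And>i. norm (f i) \<le> B"
  shows "norm (twisted K h n f j) \<le> B * (1 - min (pmf (path_pmf K n j) l) (pmf (path_pmf K n j) l')
           * (sin ((h (displacement l) - h (displacement l')) / 2))\<^sup>2)"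
proof (cases "l = l'")
  case True
  then show ?thesis using norm_twisted_le[OF f] by simp
next
  case False
  define P where "P = path_pmf K n j"
  define g where "g x = cis (h (displacement x)) * f (final_state j x)" for x
  have g: "norm (g x) \<le> B" for x by (simp add: g_def norm_mult f)
  have B: "0 \<le> B" using f[of j] norm_ge_zero order_trans by blast
  define S where "S = {l, l'}"
  have ig: "integrable (measure_pmf P) g" by (rule integrable_pmf_bounded[OF g])
  have i1: "integrable (measure_pmf P) (\<lambda>x. indicator S x *\<^sub>R g x)"
    and i2: "integrable (measure_pmf P) (\<lambda>x. indicator (- S) x *\<^sub>R g x)"
    using g B by (auto intro!: integrable_pmf_bounded[where B = B] simp: indicator_def)
  have "twisted K h n f j = measure_pmf.expectation P (\<lambda>x. indicator S x *\<^sub>R g x + indicator (- S) x *\<^sub>R g x)"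
    unfolding twisted_def P_def[symmetric] g_def[symmetric]
    by (intro Bochner_Integration.integral_cong) (auto simp: indicator_def)
  also have "\<dots> = measure_pmf.expectation P (\<lambda>x. indicator S x *\<^sub>R g x)
               + measure_pmf.expectation P (\<lambda>x. indicator (- S) x *\<^sub>R g x)"
    by (rule Bochner_Integration.integral_add[OF i1 i2])
  finally have "norm (twisted K h n f j) \<le> norm (measure_pmf.expectation P (\<lambda>x. indicator S x *\<^sub>R g x))
               + norm (measure_pmf.expectation P (\<lambda>x. indicator (- S) x *\<^sub>R g x))"
    by (simp add: norm_triangle_ineq)
  moreover have "norm (measure_pmf.expectation P (\<lambda>x. indicator (- S) x *\<^sub>R g x))
      \<le> B * (1 - pmf P l - pmf P l')"
  proof -
    have "norm (measure_pmf.expectation P (\<lambda>x. indicator (- S) x *\<^sub>R g x))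
        \<le> measure_pmf.expectation P (\<lambda>x. norm (indicator (- S) x *\<^sub>R g x))"
      by (rule integral_norm_bound)
    also have "\<dots> \<le> measure_pmf.expectation P (\<lambda>x. B * indicator (- S) x)"
      using g B
      by (intro integral_mono integrable_norm i2 integrable_pmf_bounded[where B = B])
         (auto simp: indicator_def split: if_splits)
    also have "\<dots> = B * measure_pmf.prob P (- S)" by simp
    also have "measure_pmf.prob P (- S) = 1 - measure_pmf.prob P S"
      using measure_pmf.prob_compl[of S P] by (simp add: Compl_eq_Diff_UNIV)
    also have "measure_pmf.prob P S = pmf P l + pmf P l'"
      using False by (simp add: S_def measure_measure_pmf_finite)
    finally show ?thesis by (simp add: algebra_simps)
  qed
  moreover have "norm (measure_pmf.expectation P (\<lambda>x. indicator S x *\<^sub>R g x))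
     \<le> B * (pmf P l + pmf P l' - min (pmf P l) (pmf P l') * (sin ((h (displacement l) - h (displacement l')) / 2))\<^sup>2)"
  proof -
    have "measure_pmf.expectation P (\<lambda>x. indicator S x *\<^sub>R g x) = (\<Sum>x\<in>S. pmf P x *\<^sub>R (indicator S x *\<^sub>R g x))"
      by (rule integral_measure_pmf) (auto simp: S_def indicator_def split: if_splits)
    also have "\<dots> = pmf P l *\<^sub>R g l + pmf P l' *\<^sub>R g l'"
      using False by (simp add: S_def)
    also have "\<dots> = (pmf P l *\<^sub>R cis (h (displacement l)) + pmf P l' *\<^sub>R cis (h (displacement l'))) * f (final_state j l)"
      by (simp add: g_def same algebra_simps)
    finally have "norm (measure_pmf.expectation P (\<lambda>x. indicator S x *\<^sub>R g x))
       = norm (pmf P l *\<^sub>R cis (h (displacement l)) + pmf P l' *\<^sub>R cis (h (displacement l'))) * norm (f (final_state j l))"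
      by (simp add: norm_mult)
    also have "\<dots> \<le> (pmf P l + pmf P l' - min (pmf P l) (pmf P l') * (sin ((h (displacement l) - h (displacement l')) / 2))\<^sup>2) * B"
      using norm_two_phases_le[of "pmf P l" "pmf P l'" "h (displacement l)" "h (displacement l')"]
      by (intro mult_mono f order_trans[OF norm_ge_zero]) auto
    finally show ?thesis by (simp add: mult.commute)
  qed
  ultimately show ?thesis unfolding P_def by (simp add: algebra_simps)
qed

section \<open>Reachability and contraction on the dual torus\<close>

text \<open>
  The least positive difference \<open>d\<close> of two elements of \<open>S\<close> divides all elements, for otherwise a
  remainder modulo \<open>d\<close> would be a smaller difference. Hence \<open>d = 1\<close>, and \<open>S\<close> contains two
  consecutive numbers \<open>b\<close> and \<open>b + 1\<close>, whose combinations cover everything from \<open>b\<^sup>2\<close> on.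
\<close>

lemma eventually_in_additive_Gcd_1:
  fixes S :: "nat set"
  assumes add: "\<And>a b. a \<in> S \<Longrightarrow> b \<in> S \<Longrightarrow> a + b \<in> S" and gcd: "Gcd S = 1"
  shows "\<exists>N. \<forall>n\<ge>N. n \<in> S"
proof -
  have mult: "Suc q * a \<in> S" if "a \<in> S" for a q
    using that by (induction q) (auto intro: add)
  have S1: "\<exists>s\<in>S. s > 0"
  proof (rule ccontr)
    assume "\<not> ?thesis"
    then have "Gcd S = 0" by (auto simp: Gcd_0_iff)
    then show False using gcd by simp
  qed
  then obtain s0 where s0: "s0 \<in> S" "0 < s0" by blast
  define D where "D d \<longleftrightarrow> 0 < d \<and> (\<exists>a\<in>S. \<exists>b\<in>S. a = b + d)" for d
  have "D s0" using add[OF s0(1) s0(1)] s0 unfolding D_def by blast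
  define d where "d = (LEAST d. D d)"
  have "D d" unfolding d_def using \<open>D s0\<close> by (rule LeastI)
  then obtain a b where d: "0 < d" and ab: "a \<in> S" "b \<in> S" "a = b + d" unfolding D_def by blast
  have "d dvd s" if "s \<in> S" for s
  proof (rule ccontr)
    assume "\<not> d dvd s"
    then have r: "0 < s mod d" "s mod d < d" using d by (auto simp: dvd_eq_mod_eq_0)
    define q where "q = s div d"
    have s: "s = q * d + s mod d" unfolding q_def by simp
    have "s + (Suc q * b + a) \<in> S" "Suc q * a + b \<in> S"
      using that mult[OF ab(2), of q] mult[OF ab(1), of q] ab add by blast+
    moreover have "s + (Suc q * b + a) = (Suc q * a + b) + s mod d"
      using s ab(3) by (simp add: algebra_simps)
    ultimately have "D (s mod d)" using r unfolding D_def by blast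
    then have "d \<le> s mod d" unfolding d_def by (rule Least_le)
    then show False using r by simp
  qed
  then have "d dvd Gcd S" by (rule Gcd_greatest)
  then have a: "a = Suc b" using gcd ab(3) by simp
  show ?thesis
  proof (cases "b = 0")
    case True
    then have "1 \<in> S" using ab a by simp
    then have "n \<in> S" if "1 \<le> n" for n using mult[of 1 "n - 1"] that by simp
    then show ?thesis by blast
  next
    case False
    have "n \<in> S" if n: "b * b \<le> n" for n
    proof -
      define q r where "q = n div b" and "r = n mod b"
      have r: "r < b" and nqr: "n = q * b + r" using False by (auto simp: q_def r_def)
      have "b \<le> q" unfolding q_def using n False by (simp add: less_eq_div_iff_mult_less_eq)
      then obtain t where t: "q = r + Suc t" using r by (metis less_imp_Suc_add less_le_trans add_Suc_right)
      have n2: "n = r * a + Suc t * b" unfolding nqr t a by (simp add: algebra_simps)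
      show ?thesis
      proof (cases r)
        case 0
        then show ?thesis using n2 mult[OF ab(2), of t] by simp
      next
        case (Suc r')
        then show ?thesis unfolding n2 using mult[OF ab(2), of t] mult[OF ab(1), of r'] add by blast
      qed
    qed
    then show ?thesis by blast
  qed
qed

definition reaches :: "('s \<Rightarrow> ('g \<times> 's) pmf) \<Rightarrow> nat \<Rightarrow> 's \<Rightarrow> 's \<Rightarrow> bool" where
  "reaches K n j k \<longleftrightarrow> (\<exists>l\<in>set_pmf (path_pmf K n j). final_state j l = k)"

lemma reaches_add: "reaches K a i j \<Longrightarrow> reaches K b j k \<Longrightarrow> reaches K (a + b) i k"
  unfolding reaches_def
  by (metis final_state_append path_append_in_support)

lemma eventually_all_reach:
  fixes K :: "'s::finite \<Rightarrow> ('g \<times> 's) pmf"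
  assumes irr: "\<And>j k. \<exists>n. reaches K n j k"
    and aper: "\<And>j. Gcd {n. 1 \<le> n \<and> reaches K n j j} = 1"
  shows "\<exists>N. \<forall>n\<ge>N. \<forall>j k. reaches K n j k"
proof -
  have "\<exists>N. \<forall>n\<ge>N. reaches K n j j" for j
    using eventually_in_additive_Gcd_1[OF _ aper[of j]] reaches_add
    by (smt (verit, best) mem_Collect_eq trans_le_add1)
  then obtain N where N: "\<And>j n. N j \<le> n \<Longrightarrow> reaches K n j j" by metis
  obtain r where r: "\<And>j k. reaches K (r j k) j k" using irr by metis
  have "reaches K n j k" if n: "(\<Sum>j\<in>UNIV. \<Sum>k\<in>UNIV. N j + r j k) \<le> n" for n j k
  proof -
    have "N j + r j k \<le> (\<Sum>k\<in>UNIV. N j + r j k)" by (rule member_le_sum) auto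
    also have "\<dots> \<le> (\<Sum>j\<in>UNIV. \<Sum>k\<in>UNIV. N j + r j k)"
      by (rule member_le_sum[where f = "\<lambda>j. \<Sum>k\<in>UNIV. N j + r j k"]) auto
    finally have "N j + r j k \<le> n" using n by simp
    then have "reaches K (n - r j k + r j k) j k" by (intro reaches_add[OF N r]) auto
    then show ?thesis using \<open>N j + r j k \<le> n\<close> by simp
  qed
  then show ?thesis by blast
qed

text \<open>
  The two loops have a common number of steps: only such loops contribute to the same entry of a power
  of the twisted matrix.
\<close>

definition loop_differences ::
  "('s \<Rightarrow> ('g::ab_group_add \<times> 's) pmf) \<Rightarrow> 's \<Rightarrow> 'g set" where
  "loop_differences K j = {displacement l - displacement l' | l l'. \<exists>n.
     l \<in> set_pmf (path_pmf K n j) \<and> l' \<in> set_pmf (path_pmf K n j) \<and>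
     final_state j l = j \<and> final_state j l' = j}"

lemma sin_squared_diff_le: "(sin (x - y))\<^sup>2 \<le> 2 * ((sin x)\<^sup>2 + (sin y)\<^sup>2)" for x y :: real
proof -
  have "\<bar>sin (x - y)\<bar> \<le> \<bar>sin x * cos y\<bar> + \<bar>cos x * sin y\<bar>" unfolding sin_diff by simp
  also have "\<dots> \<le> \<bar>sin x\<bar> * 1 + 1 * \<bar>sin y\<bar>"
    unfolding abs_mult by (intro add_mono mult_mono) auto
  finally have "(sin (x - y))\<^sup>2 \<le> (\<bar>sin x\<bar> + \<bar>sin y\<bar>)\<^sup>2"
    by (simp add: abs_le_square_iff[symmetric])
  also have "\<dots> \<le> 2 * ((sin x)\<^sup>2 + (sin y)\<^sup>2)"
    using sum_squares_ge_zero[of "\<bar>sin x\<bar> - \<bar>sin y\<bar>" 0]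
    by (simp add: power2_eq_square algebra_simps)
  finally show ?thesis .
qed

text \<open>
  For a difference of two loops the contraction comes from their interference, after both loops have
  been prolonged by a common loop to the required length. It passes to differences of group elements
  because \<open>(sin (x - y))\<^sup>2\<close> is at most \<open>2 * ((sin x)\<^sup>2 + (sin y)\<^sup>2)\<close>. The bound holds for all large
  \<open>n\<close>, and not just for one \<open>n\<close>, so that different group elements can be treated with the same
  number of steps; the constant \<open>c\<close> may depend on \<open>n\<close>, but not on \<open>h\<close>.
\<close>

lemma twisted_contracts_along_group_closure:
  fixes K :: "'s::finite \<Rightarrow> ('g::ab_group_add \<times> 's) pmf"
  assumes mix: "\<And>n j k. N0 \<le> n \<Longrightarrow> reaches K n j k"
    and g: "g \<in> group_closure (loop_differences K j)"
  shows "\<exists>N. \<forall>n\<ge>N. \<exists>c>0. \<forall>h f B. (\<forall>x y. h (x + y) = h x + h y) \<longrightarrow> (\<forall>i. norm (f i) \<le> B) \<longrightarrow>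
           norm (twisted K h n f j) \<le> B * (1 - c * (sin (h g / 2))\<^sup>2)"
  using g
proof induction
  case (base s)
  show ?case
  proof (cases "s = 0")
    case True
    have "norm (twisted K h n f j) \<le> B * (1 - 1 * (sin (h s / 2))\<^sup>2)"
      if h: "\<forall>x y. h (x + y) = h x + h y" and f: "\<forall>i. norm (f i) \<le> B"
      for h :: "'g \<Rightarrow> real" and f B n
    proof -
      have "h s = 0" using h[rule_format, of 0 0] True by simp
      then show ?thesis using norm_twisted_le[of f B K h n j] f by simp
    qed
    then show ?thesis using zero_less_one by blast
  next
    case False
    with base obtain l l' n0 where s: "s = displacement l - displacement l'"
      and l: "l \<in> set_pmf (path_pmf K n0 j)" "l' \<in> set_pmf (path_pmf K n0 j)"
        "final_state j l = j" "final_state j l' = j"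
      unfolding loop_differences_def by blast
    have "\<exists>c>0. \<forall>h f B. (\<forall>x y. h (x + y) = h x + h y) \<longrightarrow> (\<forall>i. norm (f i) \<le> B) \<longrightarrow>
           norm (twisted K h n f j) \<le> B * (1 - c * (sin (h s / 2))\<^sup>2)" if n: "n0 + N0 \<le> n" for n
    proof -
      from n have "reaches K (n - n0) j j" by (intro mix) simp
      then obtain u where u: "u \<in> set_pmf (path_pmf K (n - n0) j)" "final_state j u = j"
        unfolding reaches_def by blast
      have "n0 + (n - n0) = n" using n by simp
      then have lu: "l @ u \<in> set_pmf (path_pmf K n j)" "l' @ u \<in> set_pmf (path_pmf K n j)"
        using path_append_in_support[of l K n0 j u "n - n0"] path_append_in_support[of l' K n0 j u "n - n0"]
          l u by simp_all
      define c where "c = min (pmf (path_pmf K n j) (l @ u)) (pmf (path_pmf K n j) (l' @ u))"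
      have "0 < c" unfolding c_def using lu pmf_positive by (simp add: pmf_positive)
      moreover have "norm (twisted K h n f j) \<le> B * (1 - c * (sin (h s / 2))\<^sup>2)"
        if h: "\<forall>x y. h (x + y) = h x + h y" and f: "\<forall>i. norm (f i) \<le> B" for h f B
      proof -
        have "h (displacement (l @ u)) - h (displacement (l' @ u)) = h s"
          using h[rule_format, of s "displacement l'"] by (simp add: s h)
        then show ?thesis
          using norm_twisted_two_paths_le[OF lu, of f B h] l u f unfolding c_def by simp
      qed
      ultimately show ?thesis by blast
    qed
    then show ?thesis by blast
  qed
next
  case (diff s t)
  from diff.IH obtain N1 N2 where
    N1: "\<And>n. N1 \<le> n \<Longrightarrow> \<exists>c>0. \<forall>h f B. (\<forall>x y. h (x + y) = h x + h y) \<longrightarrow> (\<forall>i. norm (f i) \<le> B) \<longrightarrow>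
           norm (twisted K h n f j) \<le> B * (1 - c * (sin (h s / 2))\<^sup>2)" and
    N2: "\<And>n. N2 \<le> n \<Longrightarrow> \<exists>c>0. \<forall>h f B. (\<forall>x y. h (x + y) = h x + h y) \<longrightarrow> (\<forall>i. norm (f i) \<le> B) \<longrightarrow>
           norm (twisted K h n f j) \<le> B * (1 - c * (sin (h t / 2))\<^sup>2)" by metis
  have "\<exists>c>0. \<forall>h f B. (\<forall>x y. h (x + y) = h x + h y) \<longrightarrow> (\<forall>i. norm (f i) \<le> B) \<longrightarrow>
           norm (twisted K h n f j) \<le> B * (1 - c * (sin (h (s - t) / 2))\<^sup>2)" if n: "max N1 N2 \<le> n" for n
  proof -
    obtain c1 c2 where c: "c1 > 0" "c2 > 0"
      and c1: "\<And>h f B. (\<forall>x y. h (x + y) = h x + h y) \<Longrightarrow> (\<forall>i. norm (f i) \<le> B) \<Longrightarrow>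
           norm (twisted K h n f j) \<le> B * (1 - c1 * (sin (h s / 2))\<^sup>2)"
      and c2: "\<And>h f B. (\<forall>x y. h (x + y) = h x + h y) \<Longrightarrow> (\<forall>i. norm (f i) \<le> B) \<Longrightarrow>
           norm (twisted K h n f j) \<le> B * (1 - c2 * (sin (h t / 2))\<^sup>2)"
      using N1[of n] N2[of n] n by (metis max.bounded_iff)
    \<comment> \<open>one factor \<open>2\<close> from \<open>sin_squared_diff_le\<close>, another one from averaging the two bounds\<close>
    define c where "c = min c1 c2 / 4"
    have "norm (twisted K h n f j) \<le> B * (1 - c * (sin (h (s - t) / 2))\<^sup>2)"
      if h: "\<forall>x y. h (x + y) = h x + h y" and f: "\<forall>i. norm (f i) \<le> B" for h f B
    proof -
      have "h s = h (s - t) + h t" using h[rule_format, of "s - t" t] by simp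
      then have hd: "h (s - t) / 2 = h s / 2 - h t / 2" by (simp add: field_simps)
      have B: "0 \<le> B" using f norm_ge_zero order_trans by blast
      have "c * (sin (h (s - t) / 2))\<^sup>2 \<le> c * (2 * ((sin (h s / 2))\<^sup>2 + (sin (h t / 2))\<^sup>2))"
        unfolding hd by (rule mult_left_mono[OF sin_squared_diff_le]) (use c in \<open>simp add: c_def\<close>)
      also have "\<dots> = min c1 c2 * (sin (h s / 2))\<^sup>2 / 2 + min c1 c2 * (sin (h t / 2))\<^sup>2 / 2"
        by (simp add: c_def algebra_simps)
      also have "\<dots> \<le> c1 * (sin (h s / 2))\<^sup>2 / 2 + c2 * (sin (h t / 2))\<^sup>2 / 2"
        by (intro add_mono divide_right_mono mult_right_mono) auto
      finally have "B * (c * (sin (h (s - t) / 2))\<^sup>2) \<le> B * (c1 * (sin (h s / 2))\<^sup>2 / 2 + c2 * (sin (h t / 2))\<^sup>2 / 2)"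
        using B by (rule mult_left_mono)
      then show ?thesis using c1[OF h f] c2[OF h f] by (simp add: algebra_simps)
    qed
    then show ?thesis using c by (intro exI[of _ c]) (auto simp: c_def)
  qed
  then show ?case by blast
qed

lemma sin_ge_quarter: "x / 4 \<le> sin x" if "0 \<le> x" "x \<le> pi / 2" for x :: real
proof (cases "x \<le> pi / 3")
  case True
  have "(\<lambda>x. sin x - x / 4) 0 \<le> (\<lambda>x. sin x - x / 4) x"
  proof (rule DERIV_nonneg_imp_nondecreasing[OF that(1)])
    fix y assume y: "0 \<le> y" "y \<le> x"
    then have "cos (pi / 3) \<le> cos y" using True by (intro cos_monotone_0_pi_le) auto
    then show "\<exists>d. ((\<lambda>x. sin x - x / 4) has_real_derivative d) (at y) \<and> 0 \<le> d"
      by (intro exI[of _ "cos y - 1 / 4"] conjI) (auto intro!: derivative_eq_intros simp: cos_60)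
  qed
  then show ?thesis by simp
next
  case False
  have "x / 4 \<le> 1 / 2" using that pi_less_4 by simp
  also have "1 / 2 = sin (pi / 6)" by (simp add: sin_30)
  also have "\<dots> \<le> sin x" using that False by (intro sin_monotone_2pi_le) auto
  finally show ?thesis .
qed

text \<open>
  On the whole dual torus, and not only near the origin, the loss in the direction of a coordinate is
  at least quadratic in that coordinate.
\<close>

lemma sin_half_squared_ge: "x\<^sup>2 / 64 \<le> (sin (x / 2))\<^sup>2" if "\<bar>x\<bar> \<le> pi" for x :: real
proof -
  have "\<bar>x\<bar> / 8 \<le> sin (\<bar>x\<bar> / 2)" using sin_ge_quarter[of "\<bar>x\<bar> / 2"] that by simp
  then have "(\<bar>x\<bar> / 8)\<^sup>2 \<le> (sin (\<bar>x\<bar> / 2))\<^sup>2" by (intro power_mono) auto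
  also have "(sin (\<bar>x\<bar> / 2))\<^sup>2 = (sin (x / 2))\<^sup>2" by (cases "0 \<le> x") auto
  finally show ?thesis by (simp add: power_divide)
qed

definition character :: "('d::finite \<Rightarrow> real) \<Rightarrow> int ^ 'd \<Rightarrow> real" where
  "character \<theta> y = (\<Sum>i\<in>UNIV. \<theta> i * real_of_int (y $ i))"

lemma character_add: "character \<theta> (x + y) = character \<theta> x + character \<theta> y"
  by (simp add: character_def algebra_simps sum.distrib)

lemma character_axis [simp]: "character \<theta> (axis i 1) = \<theta> i"
  by (simp add: character_def axis_def if_distrib cong: if_cong)

text \<open>
  Each coordinate vector is generated by differences of loops, so each coordinate of \<open>\<theta>\<close> yields a
  contraction factor. The best of these factors already controls \<open>\<Sum>i. (\<theta> i)\<^sup>2\<close>, up to the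
  dimension.
\<close>

lemma twisted_gaussian_contraction:
  fixes K :: "'s::finite \<Rightarrow> ((int ^ 'd::finite) \<times> 's) pmf"
  assumes mix: "\<And>n j k. N0 \<le> n \<Longrightarrow> reaches K n j k"
    and gen: "\<And>j. group_closure (loop_differences K j) = UNIV"
  shows "\<exists>N\<ge>1. \<exists>c>0. \<forall>\<theta> f B j. (\<forall>i. \<bar>\<theta> i\<bar> \<le> pi) \<longrightarrow> (\<forall>i. norm (f i) \<le> B) \<longrightarrow>
           norm (twisted K (character \<theta>) N f j) \<le> B * exp (- c * (\<Sum>i\<in>UNIV. (\<theta> i)\<^sup>2))"
proof -
  have "\<exists>N. \<forall>n\<ge>N. \<exists>c>0. \<forall>\<theta> f B. (\<forall>i. norm (f i) \<le> B) \<longrightarrow>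
           norm (twisted K (character \<theta>) n f j) \<le> B * (1 - c * (sin (\<theta> i / 2))\<^sup>2)" for j i
    using twisted_contracts_along_group_closure[OF mix, of N0 "axis i 1" j] gen[of j]
    by simp (metis character_add character_axis)
  then obtain N where N: "\<And>j i n. N j i \<le> n \<Longrightarrow> \<exists>c>0. \<forall>\<theta> f B. (\<forall>i. norm (f i) \<le> B) \<longrightarrow>
           norm (twisted K (character \<theta>) n f j) \<le> B * (1 - c * (sin (\<theta> i / 2))\<^sup>2)" by metis
  define n where "n = Suc (Max (range (\<lambda>(j, i). N j i)))"
  have "N j i \<le> n" for j i
    unfolding n_def by (rule le_SucI) (rule Max_ge, auto)
  then have "\<exists>c>0. \<forall>\<theta> f B. (\<forall>i. norm (f i) \<le> B) \<longrightarrow>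
           norm (twisted K (character \<theta>) n f j) \<le> B * (1 - c * (sin (\<theta> i / 2))\<^sup>2)" for j i
    using N by blast
  then obtain c where c: "\<And>j i. c j i > 0" and cb: "\<And>j i \<theta> f B. (\<forall>i. norm (f i) \<le> B) \<Longrightarrow>
           norm (twisted K (character \<theta>) n f j) \<le> B * (1 - c j i * (sin (\<theta> i / 2))\<^sup>2)"
    by metis
  define c0 where "c0 = Min (range (\<lambda>(j, i). c j i))"
  have c0: "c0 > 0" unfolding c0_def by (subst Min_gr_iff) (auto simp: c)
  have c0_le: "c0 \<le> c j i" for j i unfolding c0_def by (rule Min_le) auto
  define c' where "c' = c0 / (64 * CARD('d))"
  have "norm (twisted K (character \<theta>) n f j) \<le> B * exp (- c' * (\<Sum>i\<in>UNIV. (\<theta> i)\<^sup>2))"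
    if \<theta>: "\<forall>i. \<bar>\<theta> i\<bar> \<le> pi" and f: "\<forall>i. norm (f i) \<le> B" for \<theta> f B j
  proof -
    have B: "0 \<le> B" using f norm_ge_zero order_trans by blast
    have "\<exists>i. (\<Sum>i\<in>UNIV. (\<theta> i)\<^sup>2) \<le> CARD('d) * (\<theta> i)\<^sup>2"
    proof (rule ccontr)
      assume "\<not> ?thesis"
      then have "\<And>i. CARD('d) * (\<theta> i)\<^sup>2 < (\<Sum>i\<in>UNIV. (\<theta> i)\<^sup>2)" by (auto simp: not_le)
      then have "(\<Sum>i\<in>(UNIV::'d set). CARD('d) * (\<theta> i)\<^sup>2) < (\<Sum>i\<in>(UNIV::'d set). (\<Sum>i\<in>UNIV. (\<theta> i)\<^sup>2))"
        by (intro sum_strict_mono) auto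
      then show False by (simp add: sum_distrib_left)
    qed
    then obtain i where i: "(\<Sum>i\<in>UNIV. (\<theta> i)\<^sup>2) \<le> CARD('d) * (\<theta> i)\<^sup>2" by blast
    have "c' * (\<Sum>i\<in>UNIV. (\<theta> i)\<^sup>2) \<le> c' * (CARD('d) * (\<theta> i)\<^sup>2)"
      using i c0 by (intro mult_left_mono) (auto simp: c'_def)
    also have "\<dots> = c0 * ((\<theta> i)\<^sup>2 / 64)" by (simp add: c'_def)
    also have "\<dots> \<le> c j i * (sin (\<theta> i / 2))\<^sup>2"
      using sin_half_squared_ge \<theta> c0_le c0 c by (intro mult_mono) (auto intro: less_imp_le)
    finally have *: "1 - c j i * (sin (\<theta> i / 2))\<^sup>2 \<le> 1 + - c' * (\<Sum>i\<in>UNIV. (\<theta> i)\<^sup>2)" by simp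
    have "norm (twisted K (character \<theta>) n f j) \<le> B * (1 - c j i * (sin (\<theta> i / 2))\<^sup>2)" by (rule cb[OF f])
    also have "\<dots> \<le> B * exp (- c' * (\<Sum>i\<in>UNIV. (\<theta> i)\<^sup>2))"
      using * exp_ge_add_one_self[of "- c' * (\<Sum>i\<in>UNIV. (\<theta> i)\<^sup>2)"] B
      by (intro mult_left_mono) auto
    finally show ?thesis .
  qed
  moreover have "c' > 0" using c0 by (simp add: c'_def)
  moreover have "n \<ge> 1" by (simp add: n_def)
  ultimately show ?thesis by blast
qed

lemma twisted_gaussian_bound:
  fixes K :: "'s::finite \<Rightarrow> ((int ^ 'd::finite) \<times> 's) pmf"
  assumes N: "\<And>\<theta> f B j. (\<forall>i. \<bar>\<theta> i\<bar> \<le> pi) \<Longrightarrow> (\<forall>i. norm (f i) \<le> B) \<Longrightarrow>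
           norm (twisted K (character \<theta>) N f j) \<le> B * exp (- c * (\<Sum>i\<in>UNIV. (\<theta> i)\<^sup>2))"
    and \<theta>: "\<forall>i. \<bar>\<theta> i\<bar> \<le> pi"
  shows "norm (twisted K (character \<theta>) n (\<lambda>_. 1) j) \<le> exp (- c * (n div N) * (\<Sum>i\<in>UNIV. (\<theta> i)\<^sup>2))"
proof -
  define S where "S = (\<Sum>i\<in>UNIV. (\<theta> i)\<^sup>2)"
  have *: "norm (twisted K (character \<theta>) (q * N + r) (\<lambda>_. 1) j) \<le> exp (- c * q * S)" for q r j
  proof (induction q arbitrary: j)
    case 0
    then show ?case using norm_twisted_le[of "\<lambda>_. 1" 1] by simp
  next
    case (Suc q)
    have "norm (twisted K (character \<theta>) (N + (q * N + r)) (\<lambda>_. 1) j) \<le> exp (- c * q * S) * exp (- c * S)"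
      unfolding twisted_add[of "character \<theta>" K N, OF character_add]
      using N[OF \<theta>, of "twisted K (character \<theta>) (q * N + r) (\<lambda>_. 1)" "exp (- c * q * S)"] Suc.IH
      unfolding S_def by blast
    then show ?case by (simp add: add.assoc exp_add[symmetric] algebra_simps)
  qed
  show ?thesis using *[of "n div N" "n mod N"] by (simp add: S_def)
qed

section \<open>Decay of the return probability\<close>

text \<open>
  The uniform distribution on \<open>[-pi, pi]\<close>. Restricting the underlying space, and not just the
  density, makes the bounds on the angles available at every point of the torus.
\<close>

definition angle :: "real measure" where
  "angle = density (restrict_space lborel {-pi..pi}) (\<lambda>_. ennreal (1 / (2 * pi)))"

lemma space_angle [simp]: "space angle = {-pi..pi}"
  by (simp add: angle_def space_restrict_space)

lemma borel_measurable_angle [measurable (raw)]: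
  "f \<in> borel_measurable borel \<Longrightarrow> f \<in> borel_measurable angle"
  unfolding angle_def by (simp add: measurable_restrict_space1)

lemma prob_space_angle: "prob_space angle"
proof
  have "emeasure angle (space angle) = (\<integral>\<^sup>+ x. ennreal (1 / (2 * pi)) * indicator {-pi..pi} x \<partial>lborel)"
    unfolding space_angle unfolding angle_def
    by (subst emeasure_density) (auto simp: sets_restrict_space nn_integral_restrict_space
          intro!: nn_integral_cong simp: indicator_def)
  also have "\<dots> = ennreal (1 / (2 * pi)) * ennreal (2 * pi)"
    by (subst nn_integral_cmult_indicator) auto
  also have "\<dots> = 1" by (simp add: ennreal_mult[symmetric])
  finally show "emeasure angle (space angle) = 1" .
qed

lemma integral_angle:
  fixes f :: "real \<Rightarrow> 'b::{banach, second_countable_topology}"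
  assumes [measurable]: "f \<in> borel_measurable borel"
  shows "integral\<^sup>L angle f = (\<integral>x. indicator {-pi..pi} x *\<^sub>R ((1 / (2 * pi)) *\<^sub>R f x) \<partial>lborel)"
proof -
  have "integral\<^sup>L angle f = integral\<^sup>L (restrict_space lborel {-pi..pi}) (\<lambda>x. (1 / (2 * pi)) *\<^sub>R f x)"
    unfolding angle_def by (rule integral_density) (auto intro!: measurable_restrict_space1)
  also have "\<dots> = (\<integral>x. indicator {-pi..pi} x *\<^sub>R ((1 / (2 * pi)) *\<^sub>R f x) \<partial>lborel)"
    by (rule integral_restrict_space) auto
  finally show ?thesis .
qed

lemma integral_angle_cis: "(\<integral>t. cis (t * real_of_int k) \<partial>angle) = (if k = 0 then 1 else 0)"
proof (cases "k = 0")
  case True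
  interpret prob_space angle by (rule prob_space_angle)
  show ?thesis using True prob_space by simp
next
  case False
  define F where "F t = (1 / (2 * pi)) *\<^sub>R (cis (t * k) / (\<i> * k))" for t :: real
  have "(\<integral>t. cis (t * real_of_int k) \<partial>angle)
      = (\<integral>x. indicator {-pi..pi} x *\<^sub>R ((1 / (2 * pi)) *\<^sub>R cis (x * k)) \<partial>lborel)"
    by (rule integral_angle) (auto intro!: borel_measurable_continuous_onI continuous_intros)
  also have "\<dots> = F pi - F (- pi)"
  proof (rule integral_FTC_Icc)
    fix x
    define G where "G z = exp (\<i> * of_int k * z) / (2 * of_real pi * (\<i> * of_int k))" for z :: complex
    have "(G has_field_derivative exp (\<i> * of_int k * of_real x) / (2 * of_real pi)) (at (of_real x))"
      unfolding G_def using False by (auto intro!: derivative_eq_intros simp: field_simps)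
    from has_vector_derivative_real_field[OF this, of "{-pi..pi}"]
    show "(F has_vector_derivative (1 / (2 * pi)) *\<^sub>R cis (x * k)) (at x within {-pi..pi})"
      by (simp add: F_def[abs_def] G_def cis_conv_exp scaleR_conv_of_real field_simps)
  qed (auto intro!: continuous_intros)
  also have "\<dots> = 0"
  proof -
    have "cis (pi * k) = cis (- pi * k)"
      by (simp add: complex_eq_iff sin_times_pi_eq_0)
    then show ?thesis by (simp add: F_def)
  qed
  finally show ?thesis using False by simp
qed

text \<open>
  On the whole line the Gaussian integral is \<open>sqrt (pi / a)\<close>, and division by the length \<open>2 * pi\<close>
  leaves less than \<open>1 / sqrt a\<close>.
\<close>

lemma integral_angle_gaussian:
  assumes a: "0 < a"
  shows "(\<integral>t. exp (- a * t\<^sup>2) \<partial>angle) \<le> 1 / sqrt a"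
proof -
  define \<sigma> where "\<sigma> = sqrt (1 / (2 * a))"
  have \<sigma>: "0 < \<sigma>" "\<sigma>\<^sup>2 = 1 / (2 * a)" using a by (auto simp: \<sigma>_def)
  have e: "exp (- a * t\<^sup>2) = sqrt (pi / a) * normal_density 0 \<sigma> t" for t
    using a by (simp add: normal_density_def \<sigma>(2) real_sqrt_divide)
  have "(\<integral>t. exp (- a * t\<^sup>2) \<partial>angle)
      = (\<integral>x. indicator {-pi..pi} x *\<^sub>R ((1 / (2 * pi)) *\<^sub>R exp (- a * x\<^sup>2)) \<partial>lborel)"
    by (rule integral_angle) simp
  also have "\<dots> \<le> (\<integral>x. (1 / (2 * pi)) * (sqrt (pi / a) * normal_density 0 \<sigma> x) \<partial>lborel)"
  proof (rule integral_mono)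
    show "integrable lborel (\<lambda>x. 1 / (2 * pi) * (sqrt (pi / a) * normal_density 0 \<sigma> x))"
      using \<sigma> by (intro integrable_mult_right integrable_normal_density)
    then show "integrable lborel (\<lambda>x. indicator {- pi..pi} x *\<^sub>R (1 / (2 * pi)) *\<^sub>R exp (- a * x\<^sup>2))"
      unfolding e[symmetric]
      by (intro integrable_mult_indicator) auto
  qed (unfold e, use a in \<open>auto simp: indicator_def\<close>)
  also have "\<dots> = (1 / (2 * pi)) * sqrt (pi / a)"
    using \<sigma> by (simp add: integral_normal_density)
  also have "\<dots> = 1 / (2 * sqrt pi) * (1 / sqrt a)"
  proof -
    have "sqrt (pi / a) = (pi / sqrt pi) / sqrt a"
      by (simp only: real_sqrt_divide real_div_sqrt[OF pi_ge_zero])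
    then show ?thesis by simp
  qed
  also have "\<dots> \<le> 1 * (1 / sqrt a)"
  proof (rule mult_right_mono)
    have "1 \<le> sqrt pi" using pi_ge_two by (intro real_le_rsqrt) auto
    then have "1 \<le> 2 * sqrt pi" by linarith
    then show "1 / (2 * sqrt pi) \<le> 1" by (subst divide_le_eq_1_pos) auto
  qed (use a in auto)
  finally show ?thesis by simp
qed

lemma cis_sum: "finite A \<Longrightarrow> cis (\<Sum>i\<in>A. f i) = (\<Prod>i\<in>A. cis (f i))"
  by (induction A rule: finite_induct) (auto simp: cis_mult[symmetric])

abbreviation torus :: "('d::finite \<Rightarrow> real) measure" where
  "torus \<equiv> PiM UNIV (\<lambda>_. angle)"

lemma product_angle: "product_prob_space (\<lambda>_. angle)"
  by (simp add: product_prob_space_def product_prob_space_axioms_def product_sigma_finite_def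
      prob_space_angle prob_space_imp_sigma_finite)

lemma prob_space_torus: "prob_space (torus :: ('d::finite \<Rightarrow> real) measure)"
  by (intro prob_space_PiM prob_space_angle)

lemma measurable_torus_component [measurable]: "(\<lambda>\<theta>. \<theta> i) \<in> borel_measurable (torus :: ('d::finite \<Rightarrow> real) measure)"
proof -
  have "(\<lambda>\<theta>. \<theta> i) \<in> measurable torus angle" by (rule measurable_component_singleton) simp
  moreover have "(\<lambda>x. x) \<in> borel_measurable angle" by (rule borel_measurable_angle) simp
  ultimately show ?thesis by (rule measurable_compose)
qed

lemma integral_torus_prod:
  fixes f :: "'d::finite \<Rightarrow> real \<Rightarrow> 'b::{real_normed_field,banach,second_countable_topology}"
  assumes "\<And>i. f i \<in> borel_measurable borel" "\<And>i t. norm (f i t) \<le> 1"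
  shows "(\<integral>\<theta>. (\<Prod>i\<in>UNIV. f i (\<theta> i)) \<partial>torus) = (\<Prod>i\<in>UNIV. integral\<^sup>L angle (f i))"
proof -
  interpret product_prob_space "\<lambda>_::'d. angle" by (rule product_angle)
  have "integrable angle (f i)" for i
    by (rule finite_measure.integrable_const_bound[OF prob_space.finite_measure[OF prob_space_angle], where B = 1])
       (use assms in \<open>auto intro: borel_measurable_angle\<close>)
  then show ?thesis by (intro product_integral_prod) auto
qed

lemma measurable_character [measurable]:
  "(\<lambda>\<theta>. character \<theta> y) \<in> borel_measurable (torus :: ('d::finite \<Rightarrow> real) measure)"
  unfolding character_def by measurable

lemma cis_borel [measurable]: "cis \<in> borel_measurable borel"
  by (intro borel_measurable_continuous_onI continuous_intros)

lemma integral_torus_character: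
  "(\<integral>\<theta>. cis (character \<theta> y) \<partial>(torus :: ('d::finite \<Rightarrow> real) measure)) = (if y = 0 then 1 else 0)"
proof -
  have "(\<integral>\<theta>. cis (character \<theta> y) \<partial>(torus :: ('d::finite \<Rightarrow> real) measure))
     = (\<Prod>i\<in>UNIV. \<integral>t. cis (t * real_of_int (y $ i)) \<partial>angle)"
    unfolding character_def by (subst cis_sum, simp, rule integral_torus_prod) auto
  also have "\<dots> = (if y = 0 then 1 else 0)"
    unfolding integral_angle_cis by (auto simp: vec_eq_iff)
  finally show ?thesis .
qed

text \<open>
  The characters are orthogonal to constants unless the displacement vanishes, and Fubini's theorem
  exchanges the averages over paths and over the torus.
\<close>

lemma return_probability_fourier:
  fixes K :: "'s::finite \<Rightarrow> ((int ^ 'd::finite) \<times> 's) pmf"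
  shows "measure_pmf.prob (path_pmf K n j) {l. displacement l = 0}
       = Re (\<integral>\<theta>. twisted K (character \<theta>) n (\<lambda>_. 1) j \<partial>torus)"
proof -
  let ?T = "torus :: ('d \<Rightarrow> real) measure"
  let ?P = "path_pmf K n j"
  let ?f = "\<lambda>(l :: ((int ^ 'd) \<times> 's) list) \<theta>. cis (character \<theta> (displacement l))"
  interpret T: prob_space ?T by (rule prob_space_torus)
  interpret pair_prob_space "measure_pmf ?P" ?T by unfold_locales
  have "case_prod ?f \<in> borel_measurable (count_space UNIV \<Otimes>\<^sub>M ?T)"
    by (rule measurable_pair_measure_countable1) (auto intro: countableI_type)
  then have m: "case_prod ?f \<in> borel_measurable (measure_pmf ?P \<Otimes>\<^sub>M ?T)"
    by (subst measurable_cong_sets[OF sets_pair_measure_cong[of "measure_pmf ?P" "count_space UNIV" ?T ?T] refl]) auto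
  have i: "integrable (measure_pmf ?P \<Otimes>\<^sub>M ?T) (case_prod ?f)"
    by (rule P.integrable_const_bound[where B = 1]) (auto simp: m)
  have "complex_of_real (measure_pmf.prob ?P {l. displacement l = 0})
      = (\<integral>l. of_real (indicator {l. displacement l = 0} l) \<partial>measure_pmf ?P)"
    by (subst integral_complex_of_real) simp
  also have "\<dots> = (\<integral>l. (\<integral>\<theta>. ?f l \<theta> \<partial>?T) \<partial>measure_pmf ?P)"
    unfolding integral_torus_character by (intro Bochner_Integration.integral_cong) (auto simp: indicator_def)
  also have "\<dots> = (\<integral>\<theta>. (\<integral>l. ?f l \<theta> \<partial>measure_pmf ?P) \<partial>?T)"
    by (rule Fubini_integral[OF i, symmetric])
  also have "\<dots> = (\<integral>\<theta>. twisted K (character \<theta>) n (\<lambda>_. 1) j \<partial>?T)"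
    by (simp add: twisted_def)
  finally show ?thesis by (metis Re_complex_of_real)
qed

lemma return_probability_gaussian:
  fixes K :: "'s::finite \<Rightarrow> ((int ^ 'd::finite) \<times> 's) pmf"
  assumes a: "0 < a"
    and b: "\<And>\<theta>. (\<forall>i. \<bar>\<theta> i\<bar> \<le> pi) \<Longrightarrow> norm (twisted K (character \<theta>) n (\<lambda>_. 1) j) \<le> exp (- a * (\<Sum>i\<in>UNIV. (\<theta> i)\<^sup>2))"
  shows "measure_pmf.prob (path_pmf K n j) {l. displacement l = 0} \<le> (1 / sqrt a) ^ CARD('d)"
proof -
  let ?T = "torus :: ('d \<Rightarrow> real) measure"
  interpret T: prob_space ?T by (rule prob_space_torus)
  have "measure_pmf.prob (path_pmf K n j) {l. displacement l = 0}
      \<le> norm (\<integral>\<theta>. twisted K (character \<theta>) n (\<lambda>_. 1) j \<partial>?T)"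
    unfolding return_probability_fourier by (rule complex_Re_le_cmod)
  also have "\<dots> \<le> (\<integral>\<theta>. norm (twisted K (character \<theta>) n (\<lambda>_. 1) j) \<partial>?T)"
    by (rule integral_norm_bound)
  also have "\<dots> \<le> (\<integral>\<theta>. (\<Prod>i\<in>UNIV. exp (- a * (\<theta> i)\<^sup>2)) \<partial>?T)"
  proof (rule integral_mono')
    show "integrable ?T (\<lambda>\<theta>. \<Prod>i\<in>UNIV. exp (- a * (\<theta> i)\<^sup>2))"
      using a by (intro T.integrable_const_bound[where B = 1]) (auto simp: exp_sum[symmetric] intro!: sum_nonpos AE_I2)
    show "norm (twisted K (character \<theta>) n (\<lambda>_. 1) j) \<le> (\<Prod>i\<in>UNIV. exp (- a * (\<theta> i)\<^sup>2))"
      if "\<theta> \<in> space ?T" for \<theta>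
    proof -
      have "\<forall>i. \<bar>\<theta> i\<bar> \<le> pi" using that by (auto simp: space_PiM PiE_iff abs_le_iff minus_le_iff)
      then show ?thesis
        using b[of \<theta>] by (simp add: exp_sum[symmetric] sum_distrib_left)
    qed
  qed (auto intro: prod_nonneg)
  also have "\<dots> = (\<Prod>i\<in>(UNIV :: 'd set). (\<integral>t. exp (- a * t\<^sup>2) \<partial>angle))"
    using a by (intro integral_torus_prod) auto
  also have "\<dots> \<le> (\<Prod>i\<in>(UNIV :: 'd set). 1 / sqrt a)"
    using integral_angle_gaussian[OF a] by (intro prod_mono) auto
  finally show ?thesis by simp
qed

text \<open>
  With \<open>q = n div N\<close> blocks the Gaussian bound gives \<open>O(q powr (-d/2))\<close>. Where this bound is below
  \<open>1\<close>, lowering the exponent to \<open>3/2\<close> only increases it; elsewhere a probability is at most \<open>1\<close>.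
\<close>

lemma return_probability_decay:
  fixes K :: "'s::finite \<Rightarrow> ((int ^ 'd::finite) \<times> 's) pmf"
  assumes d: "3 \<le> CARD('d)"
    and mix: "\<And>n j k. N0 \<le> n \<Longrightarrow> reaches K n j k"
    and gen: "\<And>j. group_closure (loop_differences K j) = UNIV"
  obtains C where "0 < C"
    and "\<And>n j. 1 \<le> n \<Longrightarrow> measure_pmf.prob (path_pmf K n j) {l. displacement l = 0} \<le> C / sqrt (real n) ^ 3"
proof -
  obtain N c where N: "N \<ge> 1" and c: "c > 0"
    and tw: "\<And>\<theta> f B j. (\<forall>i. \<bar>\<theta> i\<bar> \<le> pi) \<Longrightarrow> (\<forall>i. norm (f i) \<le> B) \<Longrightarrow>
           norm (twisted K (character \<theta>) N f j) \<le> B * exp (- c * (\<Sum>i\<in>UNIV. (\<theta> i)\<^sup>2))"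
    using twisted_gaussian_contraction[of N0 K, OF mix gen] by blast
  define A where "A = max (sqrt N) (sqrt (2 * N / c))"
  have A: "0 < A" using N by (simp add: A_def less_max_iff_disj)
  have main: "measure_pmf.prob (path_pmf K n j) {l. displacement l = 0} \<le> A ^ 3 / sqrt (real n) ^ 3"
    if n: "1 \<le> n" for n j
  proof (cases "sqrt n \<le> A")
    case True
    have "measure_pmf.prob (path_pmf K n j) {l. displacement l = 0} \<le> 1" by simp
    also have "1 \<le> (A / sqrt n) ^ 3" using True n by (intro one_le_power) simp
    finally show ?thesis by (simp add: power_divide)
  next
    case False
    then have "sqrt N \<le> sqrt n" by (auto simp: A_def not_le)
    then have "N \<le> n" by simp
    define q where "q = n div N"
    have q: "1 \<le> q" unfolding q_def using N \<open>N \<le> n\<close> by (simp add: Suc_le_eq div_greater_zero_iff)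
    have "n \<le> 2 * N * q"
    proof -
      have "n = q * N + n mod N" by (simp add: q_def)
      also have "\<dots> \<le> q * N + N" using N by (intro add_left_mono) (simp add: less_imp_le)
      also have "\<dots> \<le> q * N + q * N" using q by (intro add_left_mono) simp
      finally show ?thesis by (simp add: algebra_simps)
    qed
    then have nq: "real n \<le> 2 * N * q" by (metis of_nat_le_iff of_nat_mult of_nat_numeral)
    have "measure_pmf.prob (path_pmf K n j) {l. displacement l = 0} \<le> (1 / sqrt (c * q)) ^ CARD('d)"
    proof (rule return_probability_gaussian)
      show "0 < c * real q" using c q by simp
      show "norm (twisted K (character \<theta>) n (\<lambda>_. 1) j) \<le> exp (- (c * real q) * (\<Sum>i\<in>UNIV. (\<theta> i)\<^sup>2))"
        if "\<forall>i. \<bar>\<theta> i\<bar> \<le> pi" for \<theta>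
        using twisted_gaussian_bound[OF tw that, of n j] by (simp add: q_def)
    qed
    also have "\<dots> \<le> (A / sqrt n) ^ CARD('d)"
    proof (rule power_mono)
      have "1 / (c * q) \<le> (2 * N / c) / n" using nq c q n by (simp add: field_simps)
      then have "sqrt (1 / (c * q)) \<le> sqrt ((2 * N / c) / n)" by (rule real_sqrt_le_mono)
      also have "\<dots> = sqrt (2 * N / c) / sqrt n" by (rule real_sqrt_divide)
      also have "\<dots> \<le> A / sqrt n" by (intro divide_right_mono) (simp_all add: A_def)
      finally show "1 / sqrt (c * q) \<le> A / sqrt n" by (simp only: real_sqrt_divide real_sqrt_one)
    qed (use c in simp)
    also have "\<dots> \<le> (A / sqrt n) ^ 3"
      using False A n d by (intro power_decreasing) auto
    finally show ?thesis by (simp add: power_divide)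
  qed
  show ?thesis by (rule that[of "A ^ 3"]) (use A main in auto)
qed

section \<open>Mixing of the internal states\<close>

lemma expectation_pmf_cong:
  fixes f g :: "'b \<Rightarrow> real"
  assumes "\<And>x. x \<in> set_pmf p \<Longrightarrow> f x = g x"
  shows "measure_pmf.expectation p f = measure_pmf.expectation p g"
  using assms by (intro integral_cong_AE) (auto simp: AE_measure_pmf_iff)

definition evolve :: "('s \<Rightarrow> ('g \<times> 's) pmf) \<Rightarrow> nat \<Rightarrow> ('s \<Rightarrow> real) \<Rightarrow> 's \<Rightarrow> real" where
  "evolve K n f j = measure_pmf.expectation (path_pmf K n j) (\<lambda>l. f (final_state j l))"

lemma evolve_add:
  fixes f :: "'s::finite \<Rightarrow> real"
  shows "evolve K (a + b) f j = evolve K a (evolve K b f) j"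
proof -
  have "\<bar>f i\<bar> \<le> Max (range (\<lambda>i. \<bar>f i\<bar>))" for i by (rule Max_ge) auto
  then show ?thesis
    unfolding evolve_def path_pmf_add
    by (subst expectation_bind_pmf[where B = "Max (range (\<lambda>i. \<bar>f i\<bar>))"]) auto
qed

lemma evolve_bounds:
  fixes f :: "'s::finite \<Rightarrow> real"
  assumes w: "\<And>j. w \<le> measure_pmf.prob (path_pmf K n j) {l. final_state j l = k}"
    and f: "\<And>i. a \<le> f i" "\<And>i. f i \<le> b"
  shows "a + w * (f k - a) \<le> evolve K n f j" "evolve K n f j \<le> b - w * (b - f k)"
proof -
  have "\<bar>f i\<bar> \<le> max \<bar>a\<bar> \<bar>b\<bar>" for i using f(1)[of i] f(2)[of i] by linarith
  then have i: "integrable (measure_pmf (path_pmf K n j)) (\<lambda>l. f (final_state j l))"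
    by (intro integrable_pmf_bounded[where B = "max \<bar>a\<bar> \<bar>b\<bar>"]) auto
  let ?A = "{l. final_state j l = k}"
  have iA: "integrable (measure_pmf (path_pmf K n j)) (indicator ?A :: _ \<Rightarrow> real)"
    by (rule integrable_pmf_bounded[where B = 1]) (auto simp: indicator_def)
  have "a + w * (f k - a) \<le> a + measure_pmf.prob (path_pmf K n j) ?A * (f k - a)"
    using w[of j] f(1)[of k] by (intro add_left_mono mult_right_mono) auto
  also have "\<dots> = measure_pmf.expectation (path_pmf K n j) (\<lambda>l. a + indicator ?A l * (f k - a))"
    by (simp add: iA)
  also have "\<dots> \<le> evolve K n f j"
    unfolding evolve_def using f
    by (intro integral_mono i Bochner_Integration.integrable_add integrable_mult_left iA measure_pmf.integrable_const)
       (auto simp: indicator_def)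
  finally show "a + w * (f k - a) \<le> evolve K n f j" .
  have "evolve K n f j \<le> measure_pmf.expectation (path_pmf K n j) (\<lambda>l. b - indicator ?A l * (b - f k))"
    unfolding evolve_def using f
    by (intro integral_mono i Bochner_Integration.integrable_diff integrable_mult_left iA measure_pmf.integrable_const)
       (auto simp: indicator_def)
  also have "\<dots> = b - measure_pmf.prob (path_pmf K n j) ?A * (b - f k)"
    by (simp add: iA)
  also have "\<dots> \<le> b - w * (b - f k)"
    using w[of j] f(2)[of k] by (intro diff_left_mono mult_right_mono) auto
  finally show "evolve K n f j \<le> b - w * (b - f k)" .
qed

lemma sum_power_div_le:
  fixes x :: real
  assumes x: "0 \<le> x" "x < 1" and N: "N \<ge> 1"
  shows "(\<Sum>r<n. x ^ (r div N)) \<le> N / (1 - x)"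
proof -
  have "(\<Sum>r<n. x ^ (r div N)) \<le> (\<Sum>r<n * N. x ^ (r div N))"
    using x N by (intro sum_mono2) auto
  also have "\<dots> = (\<Sum>q<n. \<Sum>r\<in>{q * N..<q * N + N}. x ^ (r div N))"
    by (rule sum.nat_group[symmetric])
  also have "\<dots> = (\<Sum>q<n. \<Sum>r\<in>{q * N..<q * N + N}. x ^ q)"
  proof (intro sum.cong refl)
    fix q r assume "r \<in> {q * N..<q * N + N}"
    then have "r div N = q" by (intro div_nat_eqI) (auto simp: mult.commute)
    then show "x ^ (r div N) = x ^ q" by simp
  qed
  also have "\<dots> = N * (\<Sum>q<n. x ^ q)" by (simp add: sum_distrib_left)
  also have "\<dots> \<le> N * (1 / (1 - x))"
  proof (rule mult_left_mono)
    have "(\<Sum>q<n. x ^ q) = (1 - x ^ n) / (1 - x)" using x by (simp add: sum_gp_strict)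
    also have "\<dots> \<le> 1 / (1 - x)" using x by (intro divide_right_mono) auto
    finally show "(\<Sum>q<n. x ^ q) \<le> 1 / (1 - x)" .
  qed simp
  finally show ?thesis by simp
qed

text \<open>
  The number \<open>\<rho> n\<close> bounds the oscillation, over the initial states, of the mean of an arbitrary
  observable of the state at time \<open>n\<close> with values in \<open>[0, 1]\<close>.
\<close>

definition mixes :: "('s \<Rightarrow> ('g \<times> 's) pmf) \<Rightarrow> (nat \<Rightarrow> real) \<Rightarrow> bool" where
  "mixes K \<rho> \<longleftrightarrow> (\<forall>n f. (\<forall>i. 0 \<le> f i \<and> f i \<le> 1) \<longrightarrow>
     (\<exists>a b. b - a \<le> \<rho> n \<and> (\<forall>j. a \<le> evolve K n f j \<and> evolve K n f j \<le> b)))"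

text \<open>
  Doeblin's argument: for some \<open>N\<close> a fixed state \<open>k\<close> is reached in \<open>N\<close> steps with probability at
  least \<open>\<delta> > 0\<close> from everywhere. So \<open>N\<close> steps map the interval spanned by an observable into an
  interval that is shorter by the factor \<open>1 - \<delta>\<close>.
\<close>

lemma summable_mixing_rate:
  fixes K :: "'s::finite \<Rightarrow> ('g \<times> 's) pmf"
  assumes mix: "\<And>n j k. N0 \<le> n \<Longrightarrow> reaches K n j k"
  obtains \<rho> R where "mixes K \<rho>" "\<And>n. 0 \<le> \<rho> n" "\<And>n. (\<Sum>r<n. \<rho> r) \<le> R"
proof -
  define N where "N = Suc N0"
  obtain k :: 's where True by simp
  define \<delta> where "\<delta> = Min (range (\<lambda>j. measure_pmf.prob (path_pmf K N j) {l. final_state j l = k}))"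
  have \<delta>_le: "\<delta> \<le> measure_pmf.prob (path_pmf K N j) {l. final_state j l = k}" for j
    unfolding \<delta>_def by (rule Min_le) auto
  have "0 < measure_pmf.prob (path_pmf K N j) {l. final_state j l = k}" for j
  proof -
    have "reaches K N j k" by (rule mix) (simp add: N_def)
    then show ?thesis unfolding reaches_def by (auto intro!: measure_pmf_posI)
  qed
  then have \<delta>: "0 < \<delta>" unfolding \<delta>_def by (subst Min_gr_iff) auto
  have \<delta>1: "\<delta> \<le> 1" using \<delta>_le[of k] measure_pmf.prob_le_1 order_trans by blast
  have *: "\<exists>a b. b - a \<le> (1 - \<delta>) ^ q \<and> (\<forall>j. a \<le> evolve K (q * N + r) f j \<and> evolve K (q * N + r) f j \<le> b)"
    if f: "\<forall>i. 0 \<le> f i \<and> f i \<le> 1" for q r f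
  proof (induction q)
    case 0
    have "0 \<le> evolve K r f j \<and> evolve K r f j \<le> 1" for j
      using evolve_bounds[of 0 K r j 0 f 1 for j] f by auto
    then show ?case by (intro exI[of _ 0] exI[of _ 1]) auto
  next
    case (Suc q)
    define g where "g = evolve K (q * N + r) f"
    from Suc obtain a b where ab: "b - a \<le> (1 - \<delta>) ^ q" "\<And>j. a \<le> g j" "\<And>j. g j \<le> b"
      unfolding g_def by blast
    have "evolve K (Suc q * N + r) f = evolve K N g"
      unfolding g_def evolve_add[symmetric] by (auto simp: add.assoc evolve_add)
    moreover have "a + \<delta> * (g k - a) \<le> evolve K N g j \<and> evolve K N g j \<le> b - \<delta> * (b - g k)" for j
      using evolve_bounds[OF \<delta>_le, of a g b] ab by blast
    moreover have "(b - \<delta> * (b - g k)) - (a + \<delta> * (g k - a)) \<le> (1 - \<delta>) ^ Suc q"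
    proof -
      have "(b - \<delta> * (b - g k)) - (a + \<delta> * (g k - a)) = (1 - \<delta>) * (b - a)" by (simp add: algebra_simps)
      also have "\<dots> \<le> (1 - \<delta>) * (1 - \<delta>) ^ q" using ab(1) \<delta>1 by (intro mult_left_mono) auto
      finally show ?thesis by simp
    qed
    ultimately show ?case by metis
  qed
  have "mixes K (\<lambda>n. (1 - \<delta>) ^ (n div N))"
    unfolding mixes_def
  proof (intro allI impI)
    fix n and f :: "'s \<Rightarrow> real" assume "\<forall>i. 0 \<le> f i \<and> f i \<le> 1"
    from *[OF this, of "n div N" "n mod N"]
    show "\<exists>a b. b - a \<le> (1 - \<delta>) ^ (n div N) \<and> (\<forall>j. a \<le> evolve K n f j \<and> evolve K n f j \<le> b)"
      by simp
  qed
  then show ?thesis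
  proof (rule that)
    show "0 \<le> (1 - \<delta>) ^ (n div N)" for n using \<delta>1 by simp
    show "(\<Sum>r<n. (1 - \<delta>) ^ (r div N)) \<le> N / (1 - (1 - \<delta>))" for n
      using \<delta> \<delta>1 by (intro sum_power_div_le) (auto simp: N_def)
  qed
qed

definition walk_law :: "'s pmf \<Rightarrow> ('s \<Rightarrow> ('g \<times> 's) pmf) \<Rightarrow> nat \<Rightarrow> ('g \<times> 's) list pmf" where
  "walk_law \<nu> K n = bind_pmf \<nu> (path_pmf K n)"

lemma length_walk: "l \<in> set_pmf (walk_law \<nu> K n) \<Longrightarrow> length l = n"
  by (auto simp: walk_law_def length_path)

text \<open>
  The final state is kept beside the path, since an empty path does not determine it.
\<close>

definition stopped_law :: "'s pmf \<Rightarrow> ('s \<Rightarrow> ('g \<times> 's) pmf) \<Rightarrow> nat \<Rightarrow> (('g \<times> 's) list \<times> 's) pmf" where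
  "stopped_law \<nu> K s = bind_pmf \<nu> (\<lambda>j. map_pmf (\<lambda>l. (l, final_state j l)) (path_pmf K s j))"

lemma length_stopped: "v \<in> set_pmf (stopped_law \<nu> K s) \<Longrightarrow> length (fst v) = s"
  by (auto simp: stopped_law_def length_path)

lemma walk_law_split:
  "walk_law \<nu> K (s + r) = bind_pmf (stopped_law \<nu> K s) (\<lambda>v. map_pmf ((@) (fst v)) (path_pmf K r (snd v)))"
  unfolding walk_law_def stopped_law_def path_pmf_add
  by (simp add: bind_assoc_pmf bind_map_pmf)

lemma expectation_walk_split:
  fixes \<Phi> :: "('g \<times> 's) list \<Rightarrow> real"
  assumes "s \<le> n" "\<And>l. \<bar>\<Phi> l\<bar> \<le> B"
  shows "measure_pmf.expectation (walk_law \<nu> K n) \<Phi>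
       = measure_pmf.expectation (stopped_law \<nu> K s)
           (\<lambda>v. measure_pmf.expectation (path_pmf K (n - s) (snd v)) (\<lambda>u. \<Phi> (fst v @ u)))"
proof -
  have "n = s + (n - s)" using assms by simp
  then show ?thesis
    by (subst \<open>n = s + (n - s)\<close>, subst walk_law_split) (subst expectation_bind_pmf[OF assms(2)], simp)
qed

lemma expectation_path_drop:
  fixes G :: "('g \<times> 's) list \<Rightarrow> real"
  assumes "t \<le> n" "\<And>l. \<bar>G l\<bar> \<le> B"
  shows "measure_pmf.expectation (path_pmf K n j) (\<lambda>u. G (drop t u))
       = evolve K t (\<lambda>k. measure_pmf.expectation (path_pmf K (n - t) k) G) j"
proof -
  have n: "path_pmf K n j = path_pmf K (t + (n - t)) j" using assms by simp
  show ?thesis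
    unfolding n path_pmf_add evolve_def
    by (subst expectation_bind_pmf[where B = B])
       (use assms(2) in \<open>auto intro!: expectation_pmf_cong simp: length_path\<close>)
qed

text \<open>
  Conditionally on the first \<open>s\<close> steps, the mean of \<open>G\<close> depends on the state at time \<open>s\<close> only, and
  as a function of this state it oscillates by at most \<open>\<rho> (t - s)\<close>. It therefore differs from its
  own mean by no more than that.
\<close>

lemma covariance_le:
  fixes F G :: "('g \<times> 's) list \<Rightarrow> real"
  assumes mix: "mixes K \<rho>"
    and le: "s \<le> t" "t \<le> n"
    and F: "\<And>l. 0 \<le> F l \<and> F l \<le> 1" and G: "\<And>l. 0 \<le> G l \<and> G l \<le> 1"
  shows "\<bar>measure_pmf.expectation (walk_law \<nu> K n) (\<lambda>l. F (take s l) * G (drop t l))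
       - measure_pmf.expectation (walk_law \<nu> K n) (\<lambda>l. F (take s l))
         * measure_pmf.expectation (walk_law \<nu> K n) (\<lambda>l. G (drop t l))\<bar> \<le> \<rho> (t - s)"
proof -
  define g where "g k = measure_pmf.expectation (path_pmf K (n - t) k) G" for k
  define h where "h = evolve K (t - s) g"
  define V where "V = stopped_law \<nu> K s"
  have bF: "\<bar>F l\<bar> \<le> 1" and bG: "\<bar>G l\<bar> \<le> 1" for l using F[of l] G[of l] by auto
  have bFG: "\<bar>F l * G l'\<bar> \<le> 1" for l l' using bF[of l] bG[of l'] by (simp add: abs_mult mult_le_one)
  have g: "0 \<le> g k \<and> g k \<le> 1" for k
    using norm_expectation_pmf_le[of G 1 "path_pmf K (n - t) k"] bG G
    unfolding g_def by (auto simp: Bochner_Integration.integral_nonneg abs_le_iff)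
  then obtain a b where ab: "b - a \<le> \<rho> (t - s)" "\<And>j. a \<le> h j" "\<And>j. h j \<le> b"
    using mix unfolding mixes_def h_def by meson
  have hG: "measure_pmf.expectation (path_pmf K (n - s) k) (\<lambda>u. G (drop (t - s) u)) = h k" for k
    unfolding h_def g_def using le by (subst expectation_path_drop[where B = 1, OF _ bG]) auto
  have drop: "drop t (l @ u) = drop (t - s) u" "take s (l @ u) = l"
    if "(l, k) \<in> set_pmf V" for l k u
    using length_stopped[of "(l, k)" \<nu> K s] that le by (auto simp: V_def)
  have E1: "measure_pmf.expectation (walk_law \<nu> K n) (\<lambda>l. F (take s l) * G (drop t l))
      = measure_pmf.expectation V (\<lambda>v. F (fst v) * h (snd v))"
    using le bFG
    by (subst expectation_walk_split[of s n _ 1])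
       (auto intro!: expectation_pmf_cong simp del: take_append drop_append
          simp flip: V_def simp: drop hG)
  have E2: "measure_pmf.expectation (walk_law \<nu> K n) (\<lambda>l. F (take s l))
      = measure_pmf.expectation V (\<lambda>v. F (fst v))"
    using le bF
    by (subst expectation_walk_split[of s n _ 1])
       (auto intro!: expectation_pmf_cong simp del: take_append drop_append
          simp flip: V_def simp: drop)
  have E3: "measure_pmf.expectation (walk_law \<nu> K n) (\<lambda>l. G (drop t l))
      = measure_pmf.expectation V (\<lambda>v. h (snd v))"
    using le bG
    by (subst expectation_walk_split[of s n _ 1])
       (auto intro!: expectation_pmf_cong simp del: take_append drop_append
          simp flip: V_def simp: drop hG)
  define e where "e = measure_pmf.expectation V (\<lambda>v. h (snd v))"
  have bh: "\<bar>h k\<bar> \<le> max \<bar>a\<bar> \<bar>b\<bar>" for k using ab(2)[of k] ab(3)[of k] by linarith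
  have ih: "integrable (measure_pmf V) (\<lambda>v. h (snd v))"
    by (rule integrable_pmf_bounded[where B = "max \<bar>a\<bar> \<bar>b\<bar>"]) (use bh in auto)
  have "a \<le> e" "e \<le> b"
    unfolding e_def using ab
    by (intro measure_pmf.integral_ge_const measure_pmf.integral_le_const ih AE_I2; simp)+
  then have he: "\<bar>h k - e\<bar> \<le> b - a" for k using ab(2)[of k] ab(3)[of k] by linarith
  have "\<bar>F l * h k\<bar> \<le> max \<bar>a\<bar> \<bar>b\<bar>" for l k
    using mult_mono[OF bF[of l] bh[of k]] by (simp add: abs_mult)
  then have iFh: "integrable (measure_pmf V) (\<lambda>v. F (fst v) * h (snd v))"
    by (intro integrable_pmf_bounded[where B = "max \<bar>a\<bar> \<bar>b\<bar>"]) auto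
  have iF: "integrable (measure_pmf V) (\<lambda>v. F (fst v))"
    by (rule integrable_pmf_bounded[where B = 1]) (use bF in auto)
  have "measure_pmf.expectation V (\<lambda>v. F (fst v) * h (snd v)) - measure_pmf.expectation V (\<lambda>v. F (fst v)) * e
      = measure_pmf.expectation V (\<lambda>v. F (fst v) * (h (snd v) - e))"
    by (simp add: right_diff_distrib iFh iF)
  also have "\<bar>\<dots>\<bar> \<le> b - a"
  proof -
    have "\<bar>F l * (h k - e)\<bar> \<le> b - a" for l k
      using mult_mono[OF bF[of l] he[of k]] by (simp add: abs_mult)
    then show ?thesis
      using norm_expectation_pmf_le[of "\<lambda>v. F (fst v) * (h (snd v) - e)" "b - a" V] by simp
  qed
  finally show ?thesis unfolding E1 E2 E3 e_def[symmetric] using ab(1) by linarith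
qed

section \<open>Mean and fluctuations of the number of visited sites\<close>

text \<open>
  Sums of indicators stay sums below, because expectations are taken term by term.
\<close>

declare sum_of_bool_eq [simp del]

definition site :: "('g::ab_group_add \<times> 's) list \<Rightarrow> nat \<Rightarrow> 'g" where
  "site l i = displacement (take i l)"

lemma site_add: "site l (i + t) = site l i + displacement (take t (drop i l))"
  by (simp add: site_def take_add)

text \<open>
  Meant for the steps \<open>u\<close> that remain after some time \<open>i\<close>: the site of time \<open>i\<close> is not visited again
  within \<open>m\<close> steps. Where \<open>u\<close> ends earlier there is no further condition, so for \<open>m\<close> at least
  the length of the path the property says that the site is visited at time \<open>i\<close> for the last time.
\<close>

definition escapes :: "nat \<Rightarrow> ('g::ab_group_add \<times> 's) list \<Rightarrow> bool" where
  "escapes m u \<longleftrightarrow> (\<forall>t. 1 \<le> t \<and> t \<le> m \<and> t \<le> length u \<longrightarrow> displacement (take t u) \<noteq> 0)"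

lemma escapes_take [simp]: "escapes m (take m u) \<longleftrightarrow> escapes m u"
  by (auto simp: escapes_def min_def)

definition escape_count :: "nat \<Rightarrow> nat \<Rightarrow> ('g::ab_group_add \<times> 's) list \<Rightarrow> real" where
  "escape_count m n l = (\<Sum>i\<le>n. of_bool (escapes m (drop i l)))"

text \<open>
  Every value is counted at the last index at which it is taken.
\<close>

lemma card_image_eq_card_last:
  fixes f :: "nat \<Rightarrow> 'a"
  shows "card (f ` {..n}) = card {i\<in>{..n}. \<forall>t\<in>{i<..n}. f t \<noteq> f i}" (is "_ = card ?A")
proof -
  have "inj_on f ?A"
  proof (rule inj_onI)
    fix i t assume "i \<in> ?A" "t \<in> ?A" "f i = f t"
    then show "i = t" by (cases i t rule: linorder_cases) auto
  qed
  moreover have "f ` {..n} \<subseteq> f ` ?A"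
  proof
    fix x assume "x \<in> f ` {..n}"
    then have ne: "{t. t \<le> n \<and> f t = x} \<noteq> {}" by auto
    have fin: "finite {t. t \<le> n \<and> f t = x}" by simp
    define i where "i = Max {t. t \<le> n \<and> f t = x}"
    have i: "i \<le> n" "f i = x" using Max_in[OF fin ne] by (auto simp: i_def)
    have "t \<le> i" if "t \<le> n" "f t = x" for t unfolding i_def using that fin by (intro Max_ge) auto
    then have "i \<in> ?A" using i by fastforce
    then show "x \<in> f ` ?A" using i by blast
  qed
  then have "f ` {..n} = f ` ?A" by auto
  ultimately show ?thesis by (simp add: card_image)
qed

lemma card_sites:
  assumes "length l = n"
  shows "real (card (site l ` {..n})) = escape_count n n l"
proof -
  have "escapes n (drop i l) \<longleftrightarrow> (\<forall>t\<in>{i<..n}. site l t \<noteq> site l i)" if i: "i \<le> n" for i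
  proof
    assume e: "escapes n (drop i l)"
    show "\<forall>t\<in>{i<..n}. site l t \<noteq> site l i"
    proof
      fix t assume t: "t \<in> {i<..n}"
      then have "1 \<le> t - i \<and> t - i \<le> n \<and> t - i \<le> length (drop i l)" using assms by auto
      then have "displacement (take (t - i) (drop i l)) \<noteq> 0"
        using e unfolding escapes_def by blast
      then show "site l t \<noteq> site l i" using site_add[of l i "t - i"] t by auto
    qed
  next
    assume a: "\<forall>t\<in>{i<..n}. site l t \<noteq> site l i"
    show "escapes n (drop i l)"
      unfolding escapes_def
    proof (intro allI impI)
      fix t assume "1 \<le> t \<and> t \<le> n \<and> t \<le> length (drop i l)"
      then have "i + t \<in> {i<..n}" using i assms by auto
      then show "displacement (take t (drop i l)) \<noteq> 0" using a site_add[of l i t] by auto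
    qed
  qed
  then have "escape_count n n l = (\<Sum>i\<le>n. of_bool (\<forall>t\<in>{i<..n}. site l t \<noteq> site l i))"
    unfolding escape_count_def by (intro sum.cong) auto
  also have "\<dots> = real (card {i\<in>{..n}. \<forall>t\<in>{i<..n}. site l t \<noteq> site l i})"
    by (simp add: of_bool_def sum.If_cases Int_def)
  finally show ?thesis by (simp add: card_image_eq_card_last[of "site l"])
qed

text \<open>
  A value that is taken \<open>c\<close> times contributes \<open>2 * s * c - s\<^sup>2 * c\<^sup>2\<close> on the left, which is at most
  \<open>1\<close>. This linearised form of the Cauchy-Schwarz inequality bounds the number of values from below
  by a quantity whose expectation involves the numbers of coincidences only.
\<close>

lemma card_image_ge_collisions:
  fixes f :: "'b \<Rightarrow> 'a" and s :: real
  assumes A: "finite A"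
  shows "(\<Sum>i\<in>A. 2 * s - s\<^sup>2 * (\<Sum>t\<in>A. of_bool (f t = f i))) \<le> card (f ` A)"
proof -
  define c where "c x = real (card {i\<in>A. f i = x})" for x
  have c: "(\<Sum>t\<in>A. of_bool (f t = x)) = c x" for x
    using A by (simp add: c_def of_bool_def sum.If_cases Int_def)
  have "(\<Sum>i\<in>A. 2 * s - s\<^sup>2 * c (f i)) = (\<Sum>x\<in>f ` A. \<Sum>i\<in>{i\<in>A. f i = x}. 2 * s - s\<^sup>2 * c (f i))"
    by (rule sum.image_gen[OF A])
  also have "\<dots> = (\<Sum>x\<in>f ` A. \<Sum>i\<in>{i\<in>A. f i = x}. 2 * s - s\<^sup>2 * c x)"
    by (intro sum.cong refl) auto
  also have "\<dots> = (\<Sum>x\<in>f ` A. c x * (2 * s - s\<^sup>2 * c x))" by (simp add: c_def)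
  also have "\<dots> \<le> (\<Sum>x\<in>f ` A. 1)"
  proof (rule sum_mono)
    fix x
    have "0 \<le> (1 - s * c x)\<^sup>2" by simp
    then show "c x * (2 * s - s\<^sup>2 * c x) \<le> 1" by (simp add: power2_eq_square algebra_simps)
  qed
  finally show ?thesis by (simp add: c)
qed

text \<open>
  Comparison with the telescoping sum of \<open>2 / sqrt (t - 1) - 2 / sqrt t\<close>.
\<close>

lemma sum_inverse_sqrt_cubed_le:
  assumes m: "1 \<le> m"
  shows "(\<Sum>t\<in>{m<..n}. 1 / sqrt (real t) ^ 3) \<le> 2 / sqrt m"
proof (cases "m \<le> n")
  case True
  have "(\<Sum>t\<in>{m<..n}. 1 / sqrt (real t) ^ 3) \<le> 2 / sqrt m - 2 / sqrt n"
    using True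
  proof (induction n rule: dec_induct)
    case (step n)
    define a b where "a = sqrt (real n)" and "b = sqrt (real (Suc n))"
    have ab: "0 < a" "a \<le> b" "b * b - a * a = 1" using m step(1) by (auto simp: a_def b_def)
    have pos: "0 < a * b * (a + b)" using ab by simp
    have "1 / b ^ 3 \<le> 2 / (a * b * (a + b))"
    proof -
      have "a * b * (a + b) \<le> b * b * (b + b)" using ab by (intro mult_mono) auto
      also have "\<dots> = 2 * b ^ 3" by (simp add: power3_eq_cube algebra_simps)
      finally show ?thesis using ab pos by (simp add: field_simps)
    qed
    also have "2 / (a * b * (a + b)) = 2 * (b * b - a * a) / (a * b * (a + b))" using ab by simp
    also have "b * b - a * a = (b - a) * (a + b)" by (simp add: algebra_simps)
    also have "2 * ((b - a) * (a + b)) / (a * b * (a + b)) = 2 / a - 2 / b"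
      using ab(1,2) by (simp add: divide_simps)
    finally have "1 / sqrt (real (Suc n)) ^ 3 \<le> 2 / sqrt n - 2 / sqrt (real (Suc n))"
      unfolding a_def b_def .
    moreover have "{m<..Suc n} = insert (Suc n) {m<..n}" using step(1) by auto
    ultimately show ?case using step by simp
  qed simp
  then show ?thesis using order_trans[OF _ diff_le_self] by (smt (verit) divide_nonneg_nonneg of_nat_0_le_iff real_sqrt_ge_zero)
qed (use m in simp)

lemma sum_inverse_sqrt_cubed_le_3: "(\<Sum>t\<in>{1..n}. 1 / sqrt (real t) ^ 3) \<le> 3"
proof (cases "n = 0")
  case False
  then have "{1..n} = insert 1 {1<..n}" by auto
  then show ?thesis using sum_inverse_sqrt_cubed_le[of 1 n] by simp
qed simp

lemma expectation_path_take:
  fixes G :: "('g \<times> 's) list \<Rightarrow> real"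
  assumes "t \<le> n" "\<And>l. \<bar>G l\<bar> \<le> B"
  shows "measure_pmf.expectation (path_pmf K n j) (\<lambda>u. G (take t u)) = measure_pmf.expectation (path_pmf K t j) G"
proof -
  have n: "path_pmf K n j = path_pmf K (t + (n - t)) j" using assms by simp
  show ?thesis
    unfolding n path_pmf_add
    by (subst expectation_bind_pmf[where B = B])
       (use assms(2) in \<open>auto intro!: expectation_pmf_cong simp: length_path\<close>)
qed

text \<open>
  The two properties of the kernel on which the law of large numbers rests: internal states that mix at
  a summable rate and a return probability of order \<open>n powr (-3/2)\<close>. The initial internal state has
  an arbitrary law \<open>\<nu>\<close>.
\<close>

locale transient_walk =
  fixes \<nu> :: "'s pmf" and K :: "'s \<Rightarrow> ('g::ab_group_add \<times> 's) pmf"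
    and \<rho> :: "nat \<Rightarrow> real" and R C :: real
  assumes mixes: "mixes K \<rho>"
    and mixing_nonneg: "\<And>n. 0 \<le> \<rho> n"
    and mixing_summable: "\<And>n. (\<Sum>r<n. \<rho> r) \<le> R"
    and C_nonneg: "0 \<le> C"
    and return_le: "\<And>n j. 1 \<le> n \<Longrightarrow>
      measure_pmf.prob (path_pmf K n j) {l. displacement l = 0} \<le> C / sqrt (real n) ^ 3"
begin

abbreviation expect :: "nat \<Rightarrow> (('g \<times> 's) list \<Rightarrow> real) \<Rightarrow> real" where
  "expect n \<equiv> measure_pmf.expectation (walk_law \<nu> K n)"

lemma integrable_of_bool [simp]: "integrable (measure_pmf q) (\<lambda>x. of_bool (Q x) :: real)"
  by (rule integrable_pmf_bounded[where B = 1]) auto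

lemma integrable_escape_count [simp]: "integrable (measure_pmf q) (escape_count m n)"
  unfolding escape_count_def by simp

lemma R_nonneg: "0 \<le> R" using mixing_summable[of 0] by simp

lemma expect_return_le:
  assumes "i + t \<le> n" "1 \<le> t"
  shows "expect n (\<lambda>l. of_bool (displacement (take t (drop i l)) = 0)) \<le> C / sqrt t ^ 3"
proof -
  let ?G = "\<lambda>u :: ('g \<times> 's) list. of_bool (displacement u = 0) :: real"
  have "expect n (\<lambda>l. ?G (take t (drop i l)))
     = measure_pmf.expectation (stopped_law \<nu> K i) (\<lambda>v. measure_pmf.expectation (path_pmf K (n - i) (snd v))
         (\<lambda>u. ?G (take t (drop i (fst v @ u)))))"
    using assms by (subst expectation_walk_split[where s = i and B = 1]) auto
  also have "\<dots> = measure_pmf.expectation (stopped_law \<nu> K i) (\<lambda>v. measure_pmf.expectation (path_pmf K t (snd v)) ?G)"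
  proof (rule expectation_pmf_cong)
    fix v assume "v \<in> set_pmf (stopped_law \<nu> K i)"
    then have "length (fst v) = i" by (rule length_stopped)
    then show "measure_pmf.expectation (path_pmf K (n - i) (snd v)) (\<lambda>u. ?G (take t (drop i (fst v @ u))))
      = measure_pmf.expectation (path_pmf K t (snd v)) ?G"
      using expectation_path_take[of t "n - i" ?G 1 K "snd v"] assms by simp
  qed
  also have "\<dots> \<le> measure_pmf.expectation (stopped_law \<nu> K i) (\<lambda>v. C / sqrt t ^ 3)"
  proof (rule integral_mono)
    have eq: "measure_pmf.expectation (path_pmf K t j) ?G = measure_pmf.prob (path_pmf K t j) {l. displacement l = 0}" for j
    proof -
      have "measure_pmf.expectation (path_pmf K t j) ?G = measure_pmf.expectation (path_pmf K t j) (indicator {l. displacement l = 0})"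
        by (rule expectation_pmf_cong) (simp add: indicator_def)
      then show ?thesis by simp
    qed
    show "integrable (measure_pmf (stopped_law \<nu> K i)) (\<lambda>v. measure_pmf.expectation (path_pmf K t (snd v)) ?G)"
      unfolding eq by (rule integrable_pmf_bounded[where B = 1]) simp
    show "measure_pmf.expectation (path_pmf K t (snd v)) ?G \<le> C / sqrt t ^ 3" for v
      unfolding eq using return_le[of t] assms by simp
  qed simp
  also have "\<dots> = C / sqrt t ^ 3" by simp
  finally show ?thesis .
qed

lemma expect_collision_le:
  assumes "i < t" "t \<le> n"
  shows "expect n (\<lambda>l. of_bool (site l t = site l i)) \<le> C / sqrt (real (t - i)) ^ 3"
proof -
  have "(site l t = site l i) = (displacement (take (t - i) (drop i l)) = 0)" for l :: "('g \<times> 's) list"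
    using site_add[of l i "t - i"] assms by simp
  then show ?thesis using expect_return_le[of i "t - i" n] assms by (simp del: of_nat_diff)
qed

text \<open>
  The times before \<open>i\<close> and those after \<open>i\<close> both contribute at most \<open>C * (\<Sum>t. t powr (-3/2))\<close>, and
  this series is at most \<open>3\<close>.
\<close>

lemma expect_collisions_le:
  assumes i: "i \<le> n"
  shows "expect n (\<lambda>l. \<Sum>t\<le>n. of_bool (site l t = site l i)) \<le> 1 + 6 * C"
proof -
  let ?e = "\<lambda>t. expect n (\<lambda>l. of_bool (site l t = site l i))"
  have sum_le: "(\<Sum>t\<in>{1..k}. C / sqrt (real t) ^ 3) \<le> 3 * C" for k
    using mult_left_mono[OF sum_inverse_sqrt_cubed_le_3[of k] C_nonneg] by (simp add: sum_distrib_left)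
  have "{..n} = {..<i} \<union> {i} \<union> {i<..n}" using i by auto
  then have "(\<Sum>t\<le>n. ?e t) = (\<Sum>t<i. ?e t) + ?e i + (\<Sum>t\<in>{i<..n}. ?e t)"
    by (simp add: sum.union_disjoint Int_def del: Un_insert_right)
  moreover have "(\<Sum>t<i. ?e t) \<le> 3 * C"
  proof -
    have "(\<Sum>t<i. ?e t) \<le> (\<Sum>t<i. C / sqrt (real (i - t)) ^ 3)"
      using expect_collision_le[OF _ i] by (intro sum_mono) (simp add: eq_commute)
    also have "\<dots> = (\<Sum>t\<in>{1..i}. C / sqrt (real t) ^ 3)"
      by (rule sum.reindex_bij_witness[of _ "\<lambda>t. i - t" "\<lambda>t. i - t"]) auto
    finally show ?thesis using sum_le[of i] by linarith
  qed
  moreover have "(\<Sum>t\<in>{i<..n}. ?e t) \<le> 3 * C"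
  proof -
    have "(\<Sum>t\<in>{i<..n}. ?e t) \<le> (\<Sum>t\<in>{i<..n}. C / sqrt (real (t - i)) ^ 3)"
      using expect_collision_le by (intro sum_mono) simp
    also have "\<dots> = (\<Sum>t\<in>{1..n - i}. C / sqrt (real t) ^ 3)"
      by (rule sum.reindex_bij_witness[of _ "\<lambda>t. i + t" "\<lambda>t. t - i"]) auto
    finally show ?thesis using sum_le[of "n - i"] by linarith
  qed
  moreover have "?e i = 1" by simp
  ultimately have "(\<Sum>t\<le>n. ?e t) \<le> 1 + 6 * C" by linarith
  then show ?thesis by (subst Bochner_Integration.integral_sum) auto
qed

lemma expect_sites_ge: "(n + 1) / (1 + 6 * C) \<le> expect n (escape_count n n)"
proof -
  \<comment> \<open>the value that maximises \<open>2 * s - s\<^sup>2 * (1 + 6 * C)\<close>\<close>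
  define s where "s = 1 / (1 + 6 * C)"
  have s: "0 < s" "s * (1 + 6 * C) = 1" using C_nonneg by (auto simp: s_def)
  let ?c = "\<lambda>i l. \<Sum>t\<le>n. of_bool (site l t = site l i) :: real"
  have "(n + 1) / (1 + 6 * C) = (\<Sum>i\<le>n. 2 * s - s\<^sup>2 * (1 + 6 * C))"
    using s by (simp add: power2_eq_square mult.assoc s_def)
  also have "\<dots> \<le> (\<Sum>i\<le>n. 2 * s - s\<^sup>2 * expect n (?c i))"
    using expect_collisions_le by (intro sum_mono diff_left_mono mult_left_mono) auto
  also have "\<dots> = expect n (\<lambda>l. \<Sum>i\<le>n. 2 * s - s\<^sup>2 * ?c i l)"
    by simp
  also have "\<dots> \<le> expect n (escape_count n n)"
  proof (rule integral_mono_AE)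
    show "AE l in walk_law \<nu> K n. (\<Sum>i\<le>n. 2 * s - s\<^sup>2 * ?c i l) \<le> escape_count n n l"
    proof (rule AE_pmfI)
      fix l assume "l \<in> set_pmf (walk_law \<nu> K n)"
      then show "(\<Sum>i\<le>n. 2 * s - s\<^sup>2 * ?c i l) \<le> escape_count n n l"
        using card_image_ge_collisions[of "{..n}" s "site l"] card_sites[OF length_walk[of l \<nu> K n]] by simp
    qed
  qed simp_all
  finally show ?thesis by (simp add: add.commute)
qed

text \<open>
  The event at time \<open>i\<close> is determined by the first \<open>i + m\<close> steps, so it is nearly independent of the
  event at time \<open>t\<close> once \<open>t\<close> is well beyond \<open>i + m\<close>.
\<close>

lemma covariance_escapes_le:
  assumes "i \<le> t" "t \<le> n"
  shows "\<bar>expect n (\<lambda>l. of_bool (escapes m (drop i l)) * of_bool (escapes m (drop t l)))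
       - expect n (\<lambda>l. of_bool (escapes m (drop i l))) * expect n (\<lambda>l. of_bool (escapes m (drop t l)))\<bar>
       \<le> (if t - i < m then 1 else \<rho> (t - i - m))"
proof (cases "t - i < m")
  case True
  have "0 \<le> expect n (\<lambda>l. of_bool (Q l)) \<and> expect n (\<lambda>l. of_bool (Q l)) \<le> 1" for Q
  proof
    show "expect n (\<lambda>l. of_bool (Q l)) \<le> 1"
      using norm_expectation_pmf_le[of "\<lambda>l. of_bool (Q l) :: real" 1 "walk_law \<nu> K n"] by simp
  qed (simp add: Bochner_Integration.integral_nonneg)
  then have b: "0 \<le> expect n (\<lambda>l. of_bool (Q l))" "expect n (\<lambda>l. of_bool (Q l)) \<le> 1" for Q
    by auto
  have "\<bar>expect n (\<lambda>l. of_bool (P l \<and> Q l)) - expect n (\<lambda>l. of_bool (P l)) * expect n (\<lambda>l. of_bool (Q l))\<bar> \<le> 1" for P Q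
    using b[of "\<lambda>l. P l \<and> Q l"] mult_nonneg_nonneg[OF b(1)[of P] b(1)[of Q]]
      mult_le_one[OF b(2)[of P] b(1)[of Q] b(2)[of Q]] unfolding abs_le_iff by linarith
  then show ?thesis using True by (simp flip: of_bool_conj)
next
  case False
  define F where "F l = (of_bool (escapes m (drop i l)) :: real)" for l :: "('g \<times> 's) list"
  define G where "G l = (of_bool (escapes m l) :: real)" for l :: "('g \<times> 's) list"
  have F: "F (take (i + m) l) = of_bool (escapes m (drop i l))" for l
    by (simp add: F_def drop_take)
  have "i + m \<le> t" using False assms by simp
  from covariance_le[OF mixes this assms(2), of F G \<nu>] show ?thesis
    using False unfolding F G_def by (simp add: F_def diff_diff_eq)
qed

lemma variance_escape_count_le:
  "expect n (\<lambda>l. (escape_count m n l - expect n (escape_count m n))\<^sup>2) \<le> 2 * (n + 1) * (m + R)"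
proof -
  define X where "X i l = (of_bool (escapes m (drop i l)) :: real)" for i and l :: "('g \<times> 's) list"
  define \<kappa> where "\<kappa> r = (if r < m then 1 else \<rho> (r - m))" for r
  define c where "c i t = expect n (\<lambda>l. X i l * X t l) - expect n (X i) * expect n (X t)" for i t
  have \<kappa>0: "0 \<le> \<kappa> r" for r by (simp add: \<kappa>_def mixing_nonneg)
  have [simp]: "integrable (measure_pmf q) (X i)" for i q unfolding X_def by simp
  have [simp]: "integrable (measure_pmf q) (\<lambda>l. X i l * X t l)" for i t q
    unfolding X_def by (rule integrable_pmf_bounded[where B = 1]) auto
  have c_le: "c i t \<le> \<kappa> (t - i)" if "i \<le> t" "t \<le> n" for i t
    using covariance_escapes_le[OF that, of m] unfolding c_def \<kappa>_def X_def by linarith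
  have c_sym: "c i t = c t i" for i t by (simp add: c_def mult.commute)
  have \<kappa>_sum: "(\<Sum>r\<le>n. \<kappa> r) \<le> m + R"
  proof -
    have split: "(\<Sum>r<m + k. \<kappa> r) = m + (\<Sum>r<k. \<rho> r)" for k
      by (induction k) (auto simp: \<kappa>_def)
    have "(\<Sum>r\<le>n. \<kappa> r) \<le> (\<Sum>r<m + Suc n. \<kappa> r)" by (rule sum_mono2) (auto simp: \<kappa>0)
    also have "\<dots> \<le> m + R" unfolding split using mixing_summable[of "Suc n"] by simp
    finally show ?thesis .
  qed
  have row: "(\<Sum>t\<le>n. c i t) \<le> 2 * (m + R)" if i: "i \<le> n" for i
  proof -
    have "(\<Sum>t\<le>n. c i t) \<le> (\<Sum>t\<le>n. (if t \<le> i then \<kappa> (i - t) else 0) + (if i \<le> t then \<kappa> (t - i) else 0))"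
    proof (rule sum_mono)
      fix t assume "t \<in> {..n}"
      then show "c i t \<le> (if t \<le> i then \<kappa> (i - t) else 0) + (if i \<le> t then \<kappa> (t - i) else 0)"
        using c_le[of i t] c_le[of t i] i \<kappa>0[of 0] by (cases "i \<le> t"; cases "t \<le> i") (auto simp: c_sym[of i t])
    qed
    also have "\<dots> = (\<Sum>t\<le>i. \<kappa> (i - t)) + (\<Sum>t\<in>{i..n}. \<kappa> (t - i))"
      using i by (simp add: sum.distrib sum.If_cases Int_def)
        (intro arg_cong2[where f = "(+)"] sum.cong; auto)
    finally have "(\<Sum>t\<le>n. c i t) \<le> (\<Sum>t\<le>i. \<kappa> (i - t)) + (\<Sum>t\<in>{i..n}. \<kappa> (t - i))" .
    moreover have "(\<Sum>t\<le>i. \<kappa> (i - t)) = (\<Sum>r\<le>i. \<kappa> r)"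
      by (rule sum.reindex_bij_witness[of _ "\<lambda>t. i - t" "\<lambda>t. i - t"]) auto
    moreover have "\<dots> \<le> (\<Sum>r\<le>n. \<kappa> r)" using i by (intro sum_mono2) (auto simp: \<kappa>0)
    moreover have "(\<Sum>t\<in>{i..n}. \<kappa> (t - i)) = (\<Sum>r\<le>n - i. \<kappa> r)"
      using i by (intro sum.reindex_bij_witness[of _ "\<lambda>t. i + t" "\<lambda>t. t - i"]) auto
    moreover have "\<dots> \<le> (\<Sum>r\<le>n. \<kappa> r)" by (intro sum_mono2) (auto simp: \<kappa>0)
    ultimately show ?thesis using \<kappa>_sum by simp
  qed
  have count: "escape_count m n l = (\<Sum>i\<le>n. X i l)" for l by (simp add: escape_count_def X_def)
  define e where "e i = expect n (X i)" for i
  have Ecount: "expect n (escape_count m n) = (\<Sum>i\<le>n. e i)"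
    unfolding count e_def by simp
  have "(escape_count m n l - expect n (escape_count m n))\<^sup>2
      = (\<Sum>i\<le>n. \<Sum>t\<le>n. X i l * X t l - X i l * e t - e i * X t l + e i * e t)" for l
    unfolding Ecount count sum_subtractf[symmetric] power2_eq_square sum_product
    by (simp add: algebra_simps)
  then have "expect n (\<lambda>l. (escape_count m n l - expect n (escape_count m n))\<^sup>2) = (\<Sum>i\<le>n. \<Sum>t\<le>n. c i t)"
    by (simp add: c_def e_def)
  also have "\<dots> \<le> (\<Sum>i\<le>n. 2 * (m + R))" using row by (intro sum_mono) auto
  finally show ?thesis by (simp add: algebra_simps)
qed

text \<open>
  The two counts differ at time \<open>i\<close> only if the walk comes back to its site after more than \<open>m\<close> steps.
\<close>

lemma expect_escape_count_diff_le:
  assumes m: "1 \<le> m"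
  shows "expect n (\<lambda>l. \<bar>escape_count m n l - escape_count n n l\<bar>) \<le> (n + 1) * (2 * C / sqrt m)"
proof -
  let ?r = "\<lambda>i t l. of_bool (displacement (take t (drop i l)) = 0) :: real"
  have pt: "\<bar>escape_count m n l - escape_count n n l\<bar> \<le> (\<Sum>i\<le>n. \<Sum>t\<in>{m<..n - i}. ?r i t l)"
    if l: "length l = n" for l :: "('g \<times> 's) list"
  proof -
    have "\<bar>of_bool (escapes m (drop i l)) - of_bool (escapes n (drop i l))\<bar> \<le> (\<Sum>t\<in>{m<..n - i}. ?r i t l)" for i
    proof (cases "escapes m (drop i l) = escapes n (drop i l)")
      case True
      then show ?thesis by (simp add: sum_nonneg)
    next
      case False
      have "\<exists>t\<in>{m<..n - i}. displacement (take t (drop i l)) = 0"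
      proof (rule ccontr)
        assume a: "\<not> ?thesis"
        then have "escapes m (drop i l) = escapes n (drop i l)"
          using l unfolding escapes_def by (auto simp: not_less)
        then show False using False by simp
      qed
      then obtain t where t: "t \<in> {m<..n - i}" "displacement (take t (drop i l)) = 0" by blast
      have "1 = ?r i t l" using t by simp
      also have "\<dots> \<le> (\<Sum>t\<in>{m<..n - i}. ?r i t l)" using t by (intro member_le_sum) auto
      finally show ?thesis by (simp add: of_bool_def split: if_splits)
    qed
    then have "(\<Sum>i\<le>n. \<bar>of_bool (escapes m (drop i l)) - of_bool (escapes n (drop i l))\<bar>)
      \<le> (\<Sum>i\<le>n. \<Sum>t\<in>{m<..n - i}. ?r i t l)" by (rule sum_mono)
    then show ?thesis
      unfolding escape_count_def sum_subtractf[symmetric] by (rule order_trans[OF sum_abs])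
  qed
  have "expect n (\<lambda>l. \<bar>escape_count m n l - escape_count n n l\<bar>)
     \<le> expect n (\<lambda>l. \<Sum>i\<le>n. \<Sum>t\<in>{m<..n - i}. ?r i t l)"
    by (rule integral_mono_AE) (auto intro!: AE_pmfI pt length_walk)
  also have "\<dots> = (\<Sum>i\<le>n. \<Sum>t\<in>{m<..n - i}. expect n (?r i t))" by simp
  also have "\<dots> \<le> (\<Sum>i\<le>n. \<Sum>t\<in>{m<..n - i}. C * (1 / sqrt t ^ 3))"
    using expect_return_le m by (intro sum_mono) auto
  also have "\<dots> \<le> (\<Sum>i\<le>n. C * (2 / sqrt m))"
    unfolding sum_distrib_left[symmetric]
    using sum_inverse_sqrt_cubed_le[OF m] C_nonneg by (intro sum_mono mult_left_mono) auto
  also have "\<dots> = (n + 1) * (2 * C / sqrt m)" by simp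
  finally show ?thesis by (simp only: of_nat_add of_nat_1)
qed

text \<open>
  The count truncated at \<open>m\<close> is controlled by its variance and the error of the truncation by its mean.
  The free parameter \<open>\<tau>\<close> replaces the square root of the variance:
  \<open>|x| \<le> x\<^sup>2 / (2 * \<tau>) + \<tau> / 2\<close>.
\<close>

lemma mean_deviation_sites_le:
  fixes m n :: nat
  assumes m: "1 \<le> m" and \<tau>: "0 < \<tau>"
  shows "expect n (\<lambda>l. \<bar>escape_count n n l - expect n (escape_count n n)\<bar>)
    \<le> ((n + 1) * (m + R)) / \<tau> + \<tau> / 2 + 4 * (n + 1) * C / sqrt m"
proof -
  define S :: "('g \<times> 's) list \<Rightarrow> real" where "S = escape_count m n"
  define L :: "('g \<times> 's) list \<Rightarrow> real" where "L = escape_count n n"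
  have [simp]: "integrable (measure_pmf q) S" "integrable (measure_pmf q) L" for q
    unfolding S_def L_def by simp_all
  have bS: "\<bar>S l\<bar> \<le> real (n + 1)" for l
  proof -
    have "(\<Sum>i\<le>n. of_bool (escapes m (drop i l)) :: real) \<le> (\<Sum>i\<le>n. 1)" by (rule sum_mono) auto
    moreover have "0 \<le> (\<Sum>i\<le>n. of_bool (escapes m (drop i l)) :: real)" by (rule sum_nonneg) auto
    ultimately show ?thesis by (simp add: S_def escape_count_def)
  qed
  have i2: "integrable (measure_pmf q) (\<lambda>l. (S l - a)\<^sup>2)" for q a
  proof (rule integrable_pmf_bounded)
    show "norm ((S l - a)\<^sup>2) \<le> (real (n + 1) + \<bar>a\<bar>)\<^sup>2" for l
      using bS[of l] by (simp add: abs_le_square_iff[symmetric])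
  qed
  have dS: "\<bar>expect n S - expect n L\<bar> \<le> expect n (\<lambda>l. \<bar>S l - L l\<bar>)"
    using integral_norm_bound[of "walk_law \<nu> K n" "\<lambda>l. S l - L l"] by simp
  have "expect n (\<lambda>l. \<bar>L l - expect n L\<bar>)
     \<le> expect n (\<lambda>l. (S l - expect n S)\<^sup>2 / (2 * \<tau>) + \<tau> / 2 + \<bar>S l - L l\<bar> + \<bar>expect n S - expect n L\<bar>)"
  proof (rule integral_mono)
    fix l
    have "0 \<le> (\<bar>S l - expect n S\<bar> - \<tau>)\<^sup>2 / (2 * \<tau>)" using \<tau> by simp
    then have "\<bar>S l - expect n S\<bar> \<le> (S l - expect n S)\<^sup>2 / (2 * \<tau>) + \<tau> / 2"
      using \<tau> by (simp add: power2_diff field_simps power2_eq_square)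
    then show "\<bar>L l - expect n L\<bar> \<le> (S l - expect n S)\<^sup>2 / (2 * \<tau>) + \<tau> / 2 + \<bar>S l - L l\<bar> + \<bar>expect n S - expect n L\<bar>"
      by linarith
  qed (simp_all add: i2)
  also have "\<dots> = expect n (\<lambda>l. (S l - expect n S)\<^sup>2) / (2 * \<tau>) + \<tau> / 2 + expect n (\<lambda>l. \<bar>S l - L l\<bar>) + \<bar>expect n S - expect n L\<bar>"
    by (simp add: i2)
  also have "\<dots> \<le> (2 * (real n + 1) * (m + R)) / (2 * \<tau>) + \<tau> / 2 + 2 * ((real n + 1) * (2 * C / sqrt m))"
  proof -
    have "expect n (\<lambda>l. (S l - expect n S)\<^sup>2) / (2 * \<tau>) \<le> (2 * (real n + 1) * (m + R)) / (2 * \<tau>)"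
      using variance_escape_count_le[of n m] \<tau> unfolding S_def by (intro divide_right_mono) auto
    then show ?thesis using expect_escape_count_diff_le[OF m, of n] dS unfolding S_def L_def by linarith
  qed
  also have "\<dots> = ((n + 1) * (m + R)) / \<tau> + \<tau> / 2 + 4 * (n + 1) * C / sqrt m"
    using \<tau> by (simp add: field_simps)
  finally show ?thesis unfolding L_def .
qed

text \<open>
  For \<open>n = k ^ 8\<close> the three terms balance at the order \<open>k ^ 6\<close> with \<open>m = k ^ 4\<close> and \<open>\<tau> = k ^ 6\<close>.
\<close>

lemma mean_deviation_sites_eighth_power_le:
  assumes k: "1 \<le> k"
  shows "expect (k ^ 8) (\<lambda>l. \<bar>escape_count (k ^ 8) (k ^ 8) l - expect (k ^ 8) (escape_count (k ^ 8) (k ^ 8))\<bar>)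
    \<le> (3 + 2 * R + 8 * C) * real k ^ 6"
proof -
  have k1: "1 \<le> real k" using k by simp
  have sq: "sqrt (real (k ^ 4)) = real k ^ 2"
    by (rule real_sqrt_unique) (simp_all flip: power_mult)
  have "expect (k ^ 8) (\<lambda>l. \<bar>escape_count (k ^ 8) (k ^ 8) l - expect (k ^ 8) (escape_count (k ^ 8) (k ^ 8))\<bar>)
    \<le> (real (k ^ 8) + 1) * (real (k ^ 4) + R) / real k ^ 6 + real k ^ 6 / 2 + 4 * (real (k ^ 8) + 1) * C / real k ^ 2"
    using mean_deviation_sites_le[of "k ^ 4" "real k ^ 6" "k ^ 8"] k unfolding sq by (simp add: algebra_simps)
  also have "\<dots> \<le> (2 * real k ^ 8) * ((1 + R) * real k ^ 4) / real k ^ 6 + real k ^ 6 / 2 + 4 * (2 * real k ^ 8) * C / real k ^ 2"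
  proof -
    have p: "1 \<le> real k ^ j" for j using k1 by (rule one_le_power)
    have "R \<le> R * real k ^ 4" using p[of 4] R_nonneg by (simp add: mult_le_cancel_left1)
    then show ?thesis
      using p[of 8] p[of 4] R_nonneg C_nonneg k1
      by (intro add_mono divide_right_mono mult_mono mult_right_mono) (auto simp: algebra_simps)
  qed
  also have "\<dots> = (2 * (1 + R) + 1 / 2 + 8 * C) * real k ^ 6"
  proof -
    define a where "a = real k ^ 2"
    have "a \<noteq> 0" "real k ^ 8 = a ^ 4" "real k ^ 4 = a ^ 2" "real k ^ 6 = a ^ 3" "real k ^ 2 = a"
      using k1 by (simp_all add: a_def flip: power_mult)
    then show ?thesis by (simp add: field_simps eval_nat_numeral)
  qed
  also have "\<dots> \<le> (3 + 2 * R + 8 * C) * real k ^ 6"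
    by (rule mult_right_mono) auto
  finally show ?thesis .
qed

end

section \<open>Almost sure convergence\<close>

text \<open>
  Between \<open>k ^ 8\<close> and \<open>(k + 1) ^ 8\<close> monotonicity confines \<open>L - E\<close> by its values at the two ends and
  the increment of \<open>E\<close>, which is at most the length of the interval and so of smaller order than
  \<open>k ^ 8\<close>.
\<close>

lemma ratio_tends_to_1_from_eighth_powers:
  fixes L E :: "nat \<Rightarrow> real"
  assumes L: "mono L" and E: "mono E" and E1: "\<And>n. E (Suc n) \<le> E n + 1"
    and s: "0 < s" "\<And>n. s * real n \<le> E n"
    and lim: "(\<lambda>k. \<bar>L (k ^ 8) - E (k ^ 8)\<bar> / real (k ^ 8)) \<longlonglongrightarrow> 0"
  shows "(\<lambda>n. L n / E n) \<longlonglongrightarrow> 1"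
proof -
  define D where "D k = \<bar>L (k ^ 8) - E (k ^ 8)\<bar> / real (k ^ 8)" for k
  define q where "q k = (real (Suc k) / real k) ^ 8" for k
  define b where "b k = (D k + D (Suc k) * q k + (q k - 1)) / s" for k
  define r where "r n = nat \<lfloor>root 8 (real n)\<rfloor>" for n
  have r: "r n ^ 8 \<le> n" "n < Suc (r n) ^ 8" for n
  proof -
    have r: "real (r n) = of_int \<lfloor>root 8 (real n)\<rfloor>" by (simp add: r_def)
    then have le: "real (r n) \<le> root 8 (real n)" "root 8 (real n) < real (Suc (r n))" by linarith+
    have "real (r n) ^ 8 \<le> root 8 (real n) ^ 8" by (rule power_mono[OF le(1)]) simp
    moreover have "root 8 (real n) ^ 8 < real (Suc (r n)) ^ 8" by (rule power_strict_mono[OF le(2)]) simp_all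
    ultimately have "real (r n ^ 8) \<le> real n" "real n < real (Suc (r n) ^ 8)" by simp_all
    then show "r n ^ 8 \<le> n" "n < Suc (r n) ^ 8" unfolding of_nat_le_iff of_nat_less_iff by simp_all
  qed
  have r_lim: "filterlim r at_top sequentially"
    unfolding filterlim_at_top eventually_sequentially
  proof
    fix K
    have "K \<le> r n" if "K ^ 8 \<le> n" for n
    proof (rule ccontr)
      assume "\<not> K \<le> r n"
      then have "Suc (r n) ^ 8 \<le> K ^ 8" by (intro power_mono) auto
      then show False using r(2)[of n] that by linarith
    qed
    then show "\<exists>N. \<forall>n\<ge>N. K \<le> r n" by blast
  qed
  have q_lim: "q \<longlonglongrightarrow> 1"
  proof -
    have "(\<lambda>k. (1 + 1 / real k) ^ 8) \<longlonglongrightarrow> (1 + 0) ^ 8"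
      by (intro tendsto_intros lim_1_over_n)
    moreover have "eventually (\<lambda>k. (1 + 1 / real k) ^ 8 = q k) sequentially"
      using eventually_gt_at_top[of 0] by eventually_elim (simp add: q_def field_simps)
    ultimately show ?thesis by (simp add: tendsto_cong)
  qed
  have D_lim: "D \<longlonglongrightarrow> 0" using lim by (simp add: D_def[abs_def])
  have "b \<longlonglongrightarrow> (0 + 0 * 1 + (1 - 1)) / s"
    unfolding b_def using s by (intro tendsto_intros q_lim D_lim LIMSEQ_Suc[OF D_lim]) auto
  then have "b \<longlonglongrightarrow> 0" by simp
  then have b_lim: "(\<lambda>n. b (r n)) \<longlonglongrightarrow> 0" using r_lim by (rule filterlim_compose)
  have step: "E (m + t) \<le> E m + t" for m t
    by (induction t) (auto intro: order_trans[OF E1])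
  have bound: "norm (L n / E n - 1) \<le> b (r n)" if n: "1 \<le> n" for n
  proof -
    define k where "k = r n"
    define a where "a = k ^ 8"
    define a' where "a' = Suc k ^ 8"
    have a: "a \<le> n" "n \<le> a'" using r[of n] by (auto simp: k_def a_def a'_def)
    have "k \<noteq> 0"
    proof
      assume "k = 0"
      then have "n < 1" using r(2)[of n] by (simp add: k_def)
      then show False using n by simp
    qed
    then have a0: "0 < real a" "0 < real a'" by (auto simp: a_def a'_def)
    have "L a \<le> L n" "L n \<le> L a'" "E a \<le> E n" "E n \<le> E a'"
      using a L E by (auto dest: monoD)
    moreover have "E a' \<le> E a + (real a' - real a)"
      using step[of a "a' - a"] a by (simp add: of_nat_diff)
    ultimately have "\<bar>L n - E n\<bar> \<le> \<bar>L a - E a\<bar> + \<bar>L a' - E a'\<bar> + (real a' - real a)" by linarith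
    also have "\<dots> = real a * (D k + D (Suc k) * q k + (q k - 1))"
    proof -
      have q: "real a' = real a * q k"
        using a0 by (simp add: q_def a_def a'_def power_divide)
      have "\<bar>L a - E a\<bar> = real a * D k" "\<bar>L a' - E a'\<bar> = real a' * D (Suc k)"
        using a0 unfolding D_def a_def[symmetric] a'_def[symmetric] by simp_all
      then show ?thesis unfolding q by (simp add: algebra_simps)
    qed
    finally have diff: "\<bar>L n - E n\<bar> \<le> (s * real a) * b k" using s by (simp add: b_def)
    have En: "s * real a \<le> E n" using s(2)[of n] a s(1)
      by (meson mult_left_mono of_nat_le_iff order_trans less_imp_le)
    have pos: "0 < s * real a" using s a0 by simp
    then have "0 < E n" using En by linarith
    have "0 \<le> (s * real a) * b k" using diff by linarith
    then have "0 \<le> b k" using pos by (simp only: zero_le_mult_iff) linarith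
    have "norm (L n / E n - 1) = \<bar>L n - E n\<bar> / E n"
      using \<open>0 < E n\<close> by (simp add: abs_div_pos diff_divide_distrib[symmetric] field_simps flip: abs_divide)
    also have "\<dots> \<le> (s * real a) * b k / E n"
      using diff \<open>0 < E n\<close> by (intro divide_right_mono) auto
    also have "\<dots> \<le> E n * b k / E n"
      using En \<open>0 \<le> b k\<close> \<open>0 < E n\<close> by (intro divide_right_mono mult_right_mono) auto
    finally show ?thesis using \<open>0 < E n\<close> by (simp add: k_def)
  qed
  have "(\<lambda>n. L n / E n - 1) \<longlonglongrightarrow> 0"
    by (rule Lim_null_comparison[OF _ b_lim])
       (rule eventually_mono[OF eventually_ge_at_top[of 1] bound])
  then show ?thesis by (simp add: LIM_zero_iff)
qed

lemma AE_tendsto_0_if_summable_integrals: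
  fixes f :: "nat \<Rightarrow> 'a \<Rightarrow> real"
  assumes i: "\<And>k. integrable M (f k)" and nn: "\<And>k x. 0 \<le> f k x"
    and s: "summable (\<lambda>k. integral\<^sup>L M (f k))"
  shows "AE x in M. (\<lambda>k. f k x) \<longlonglongrightarrow> 0"
proof -
  have [measurable]: "f k \<in> borel_measurable M" for k using i by auto
  have "(\<integral>\<^sup>+ x. (\<Sum>k. ennreal (f k x)) \<partial>M) = (\<Sum>k. \<integral>\<^sup>+ x. ennreal (f k x) \<partial>M)"
    by (rule nn_integral_suminf) measurable
  also have "\<dots> = (\<Sum>k. ennreal (integral\<^sup>L M (f k)))"
    using i nn by (simp add: nn_integral_eq_integral)
  also have "\<dots> \<noteq> \<infinity>"
    unfolding infinity_ennreal_def
    by (rule ennreal_suminf_neq_top[OF s]) (rule Bochner_Integration.integral_nonneg, rule nn)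
  finally have "AE x in M. (\<Sum>k. ennreal (f k x)) \<noteq> \<infinity>"
    by (intro nn_integral_PInf_AE) auto
  then show ?thesis
  proof eventually_elim
    case (elim x)
    then have "summable (\<lambda>k. f k x)" using nn by (intro summable_suminf_not_top) auto
    then show ?case by (rule summable_LIMSEQ_zero)
  qed
qed

definition step_kernel :: "('d::finite, 's::finite) weights \<Rightarrow> 's \<Rightarrow> ((int ^ 'd) \<times> 's) pmf" where
  "step_kernel p j = embed_pmf (\<lambda>(y, k). p y j k)"

lemma pmf_step_kernel:
  assumes "rw_weights p"
  shows "pmf (step_kernel p j) (y, k) = p y j k"
proof -
  let ?f = "\<lambda>(y, k). p y j k"
  have nn: "0 \<le> ?f z" for z using assms by (auto simp: rw_weights_def split: prod.split)
  have hs: "(?f has_sum 1) UNIV" using assms by (simp add: rw_weights_def)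
  then have "(\<lambda>z. norm (?f z)) summable_on UNIV"
    using nn by (simp add: has_sum_imp_summable)
  then have a: "Infinite_Set_Sum.abs_summable_on ?f UNIV"
    unfolding abs_summable_equivalent .
  have "(\<integral>\<^sup>+ z. ennreal (?f z) \<partial>count_space UNIV) = ennreal (infsetsum ?f UNIV)"
    by (rule nn_integral_conv_infsetsum[OF a]) (rule nn)
  also have "infsetsum ?f UNIV = 1"
    using infsetsum_infsum[OF a] infsumI[OF hs] by simp
  finally have "pmf (step_kernel p j) z = ?f z" for z
    unfolding step_kernel_def by (intro pmf_embed_pmf nn) simp
  then show ?thesis by simp
qed

text \<open>
  Paths are generated from their first step on, whereas the process and the \<open>n\<close>-step weights are
  extended at the end.
\<close>

lemma pmf_path_snoc:
  fixes K :: "'s \<Rightarrow> ('g \<times> 's) pmf"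
  shows "pmf (path_pmf K (Suc n) j) (l @ [z]) = pmf (path_pmf K n j) l * pmf (K (final_state j l)) z"
proof -
  have inj: "inj (\<lambda>z. x @ [z])" for x :: "('g \<times> 's) list" by (rule injI) simp
  have "path_pmf K (Suc n) j = path_pmf K (n + 1) j" by simp
  also have "\<dots> = bind_pmf (path_pmf K n j) (\<lambda>x. map_pmf (\<lambda>z. x @ [z]) (K (final_state j x)))"
    unfolding path_pmf_add by (simp add: pmf.map_comp o_def flip: map_pmf_def)
  finally have "pmf (path_pmf K (Suc n) j) (l @ [z])
      = measure_pmf.expectation (path_pmf K n j) (\<lambda>x. pmf (map_pmf (\<lambda>z. x @ [z]) (K (final_state j x))) (l @ [z]))"
    by (simp add: pmf_bind)
  also have "\<dots> = (\<Sum>x\<in>{l}. pmf (map_pmf (\<lambda>z. x @ [z]) (K (final_state j x))) (l @ [z]) * pmf (path_pmf K n j) x)"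
  proof (rule integral_measure_pmf_real)
    show "x \<in> {l}" if "pmf (map_pmf (\<lambda>z. x @ [z]) (K (final_state j x))) (l @ [z]) \<noteq> 0" for x
    proof (rule ccontr)
      assume "x \<notin> {l}"
      then have "l @ [z] \<notin> (\<lambda>z. x @ [z]) ` set_pmf (K (final_state j x))" by auto
      then show False using that by (simp add: pmf_map_outside)
    qed
  qed simp
  also have "\<dots> = pmf (path_pmf K n j) l * pmf (K (final_state j l)) z"
    using pmf_map_inj'[OF inj, of l "K (final_state j l)" z] by simp
  finally show ?thesis .
qed

lemma path_of_rw_step:
  assumes w: "rw_weights p" and "rw_step p n y j k \<noteq> 0"
  shows "\<exists>l\<in>set_pmf (path_pmf (step_kernel p) n j). displacement l = y \<and> final_state j l = k"
  using assms(2)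
proof (induction n arbitrary: y k)
  case 0
  then show ?case by (auto split: if_splits)
next
  case (Suc n)
  then have "\<exists>z i. rw_step p n z j i * p (y - z) i k \<noteq> 0"
    by (metis (no_types, lifting) case_prod_conv infsum_0 rw_step.simps(2) surj_pair)
  then obtain z i where zi: "rw_step p n z j i \<noteq> 0" "p (y - z) i k \<noteq> 0" by auto
  from Suc.IH[OF zi(1)] obtain l where l: "l \<in> set_pmf (path_pmf (step_kernel p) n j)"
    "displacement l = z" "final_state j l = i" by blast
  have "pmf (path_pmf (step_kernel p) (Suc n) j) (l @ [(y - z, k)]) \<noteq> 0"
    unfolding pmf_path_snoc using l zi by (simp add: pmf_step_kernel[OF w] set_pmf_iff)
  then have "l @ [(y - z, k)] \<in> set_pmf (path_pmf (step_kernel p) (Suc n) j)"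
    by (simp add: set_pmf_iff del: path_pmf.simps)
  then show ?case using l by (intro bexI[of _ "l @ [(y - z, k)]"]) simp_all
qed

text \<open>
  A matrix with a nonzero entry is not the default value of a divergent sum, so the entry can be
  computed termwise.
\<close>

lemma weight_of_rw_Q:
  fixes p :: "('d::finite, 's::finite) weights"
  assumes "rw_Q p $ j $ i \<noteq> 0"
  shows "\<exists>y. p y j i \<noteq> 0"
proof (rule ccontr)
  assume "\<not> ?thesis"
  then have z: "rw_A p y $ j $ i = 0" for y by (simp add: rw_A_def)
  have "rw_A p summable_on UNIV"
    using assms infsum_not_exists[of "rw_A p" UNIV] unfolding rw_Q_def by fastforce
  then have "(rw_A p has_sum rw_Q p) UNIV" by (simp add: rw_Q_def)
  then have "((\<lambda>A. A $ j $ i) \<circ> rw_A p has_sum rw_Q p $ j $ i) UNIV"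
    by (rule has_sum_comm_additive[rotated 2]) (auto intro!: additive.intro tendsto_intros)
  then have "((\<lambda>_. 0) has_sum rw_Q p $ j $ i) (UNIV :: (int ^ 'd) set)" by (simp add: o_def z)
  then show False using assms has_sum_0_simp has_sum_unique by blast
qed

lemma reaches_of_mat_power:
  assumes w: "rw_weights p" and "mat_power (rw_Q p) n $ j $ k \<noteq> 0"
  shows "reaches (step_kernel p) n j k"
  using assms(2)
proof (induction n arbitrary: j)
  case 0
  then show ?case by (auto simp: mat_power_def mat_def reaches_def split: if_splits)
next
  case (Suc n)
  have "mat_power (rw_Q p) (Suc n) $ j $ k = (\<Sum>i\<in>UNIV. rw_Q p $ j $ i * mat_power (rw_Q p) n $ i $ k)"
    by (simp add: mat_power_def matrix_matrix_mult_def)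
  then obtain i where i: "rw_Q p $ j $ i \<noteq> 0" "mat_power (rw_Q p) n $ i $ k \<noteq> 0"
    using Suc.prems by (metis (no_types, lifting) mult_eq_0_iff sum.neutral)
  from weight_of_rw_Q[OF i(1)] obtain y where "p y j i \<noteq> 0" by blast
  then have "(y, i) \<in> set_pmf (step_kernel p j)" by (simp add: set_pmf_iff pmf_step_kernel[OF w])
  then have "reaches (step_kernel p) 1 j i"
    by (auto simp: reaches_def map_pmf_def[symmetric] intro!: bexI[of _ "[(y, i)]"] bexI[of _ "(y, i)"])
  from reaches_add[OF this Suc.IH[OF i(2)]] show ?case by simp
qed

lemma group_closure_mono:
  fixes S T :: "'g::ab_group_add set"
  assumes "S \<subseteq> T" shows "group_closure S \<subseteq> group_closure T"
proof
  fix x assume "x \<in> group_closure S"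
  then show "x \<in> group_closure T"
    by induction (use assms in \<open>auto intro: group_closure.intros\<close>)
qed

lemma transient_walk_step_kernel:
  fixes p :: "('d::finite, 's::finite) weights"
  assumes d: "3 \<le> CARD('d)" and w: "rw_weights p"
    and irr: "irreducible_matrix (rw_Q p)" and aper: "aperiodic_matrix (rw_Q p)"
    and arith: "trivial_arithmetic p"
  obtains \<rho> R C where "transient_walk (step_kernel p) \<rho> R C"
proof -
  let ?K = "step_kernel p"
  have "\<exists>n. reaches ?K n j k" for j k
    using irr reaches_of_mat_power[OF w] unfolding irreducible_matrix_def by (metis less_irrefl)
  moreover have "Gcd {n. 1 \<le> n \<and> reaches ?K n j j} = 1" for j
  proof -
    have "{n. 1 \<le> n \<and> 0 < mat_power (rw_Q p) n $ j $ j} \<subseteq> {n. 1 \<le> n \<and> reaches ?K n j j}"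
      using reaches_of_mat_power[OF w] by fastforce
    then have "Gcd {n. 1 \<le> n \<and> reaches ?K n j j} dvd Gcd {n. 1 \<le> n \<and> 0 < mat_power (rw_Q p) n $ j $ j}"
      by (intro Gcd_greatest Gcd_dvd) auto
    then show ?thesis using aper by (simp add: aperiodic_matrix_def)
  qed
  ultimately obtain N where N: "\<And>n j k. N \<le> n \<Longrightarrow> reaches ?K n j k"
    using eventually_all_reach[of ?K] by metis
  have gen: "group_closure (loop_differences ?K j) = UNIV" for j
  proof -
    have "{y - y' | y y'. \<exists>n\<ge>1. 0 < rw_step p n y j j \<and> 0 < rw_step p n y' j j} \<subseteq> loop_differences ?K j"
    proof clarify
      fix y y' n assume "0 < rw_step p n y j j" "0 < rw_step p n y' j j"
      then obtain l l' where "l \<in> set_pmf (path_pmf ?K n j)" "displacement l = y" "final_state j l = j"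
        "l' \<in> set_pmf (path_pmf ?K n j)" "displacement l' = y'" "final_state j l' = j"
        using path_of_rw_step[OF w] by (metis less_irrefl)
      then show "y - y' \<in> loop_differences ?K j" unfolding loop_differences_def by blast
    qed
    from group_closure_mono[OF this] show ?thesis using arith unfolding trivial_arithmetic_def by auto
  qed
  obtain \<rho> R where "mixes ?K \<rho>" "\<And>n. 0 \<le> \<rho> n" "\<And>n. (\<Sum>r<n. \<rho> r) \<le> R"
    using summable_mixing_rate[of N ?K] N by blast
  moreover obtain C where "0 < C"
    "\<And>n j. 1 \<le> n \<Longrightarrow> measure_pmf.prob (path_pmf ?K n j) {l. displacement l = 0} \<le> C / sqrt (real n) ^ 3"
    using return_probability_decay[of N ?K, OF d N gen] by blast
  ultimately have "transient_walk ?K \<rho> R C"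
    by unfold_locales auto
  then show ?thesis by (rule that)
qed

context rwwis
begin

definition increments :: "nat \<Rightarrow> 'w \<Rightarrow> ((int ^ 'd) \<times> 's) list" where
  "increments n \<omega> = map (\<lambda>i. (\<eta> (Suc i) \<omega> - \<eta> i \<omega>, \<epsilon> (Suc i) \<omega>)) [0..<n]"

lemma length_increments [simp]: "length (increments n \<omega>) = n"
  by (simp add: increments_def)

lemma measurable_increments [measurable]: "increments n \<in> measurable M (count_space UNIV)"
proof (induction n)
  case 0
  then show ?case by (simp add: increments_def)
next
  case (Suc n)
  note [measurable] = measurable_position measurable_state Suc.IH
  have "increments (Suc n) = (\<lambda>\<omega>. increments n \<omega> @ [(\<eta> (Suc n) \<omega> - \<eta> n \<omega>, \<epsilon> (Suc n) \<omega>)])"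
    by (simp add: increments_def fun_eq_iff)
  then show ?case by simp
qed

definition initial_law :: "'s pmf" where
  "initial_law = embed_pmf (\<lambda>j. prob {\<omega> \<in> space M. \<epsilon> 0 \<omega> = j})"

lemma pmf_initial_law: "pmf initial_law j = prob {\<omega> \<in> space M. \<epsilon> 0 \<omega> = j}"
proof -
  note [measurable] = measurable_state
  have "(\<integral>\<^sup>+ j. ennreal (prob {\<omega> \<in> space M. \<epsilon> 0 \<omega> = j}) \<partial>count_space UNIV)
      = (\<Sum>j\<in>UNIV. ennreal (prob {\<omega> \<in> space M. \<epsilon> 0 \<omega> = j}))"
    by (rule nn_integral_count_space_finite) simp
  also have "\<dots> = ennreal (\<Sum>j\<in>UNIV. prob {\<omega> \<in> space M. \<epsilon> 0 \<omega> = j})" by (rule sum_ennreal) simp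
  also have "(\<Sum>j\<in>UNIV. prob {\<omega> \<in> space M. \<epsilon> 0 \<omega> = j}) = prob (\<Union>j\<in>UNIV. {\<omega> \<in> space M. \<epsilon> 0 \<omega> = j})"
    by (rule finite_measure_finite_Union[symmetric]) (auto simp: disjoint_family_on_def)
  also have "(\<Union>j\<in>UNIV. {\<omega> \<in> space M. \<epsilon> 0 \<omega> = j}) = space M" by auto
  finally show ?thesis
    unfolding initial_law_def by (intro pmf_embed_pmf) (simp_all add: prob_space)
qed

text \<open>
  Prescribing the positions and states up to time \<open>n\<close>, as in the Markov property, amounts to
  prescribing the start and the first \<open>n\<close> steps.
\<close>

lemma trajectory_iff:
  assumes "n \<le> length l"
  shows "(\<forall>i\<le>n. \<eta> i \<omega> = site l i \<and> \<epsilon> i \<omega> = final_state j (take i l))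
    \<longleftrightarrow> \<eta> 0 \<omega> = 0 \<and> \<epsilon> 0 \<omega> = j \<and> increments n \<omega> = take n l"
  using assms
proof (induction n)
  case 0
  then show ?case by (simp add: site_def increments_def)
next
  case (Suc n)
  have t: "take (Suc n) l = take n l @ [l ! n]" using Suc.prems by (simp add: take_Suc_conv_app_nth)
  have s: "site l (Suc n) = site l n + fst (l ! n)" by (simp add: site_def t)
  have f: "final_state j (take (Suc n) l) = snd (l ! n)" by (simp add: t)
  have i: "increments (Suc n) \<omega> = increments n \<omega> @ [(\<eta> (Suc n) \<omega> - \<eta> n \<omega>, \<epsilon> (Suc n) \<omega>)]"
    by (simp add: increments_def)
  have "(\<forall>i\<le>Suc n. \<eta> i \<omega> = site l i \<and> \<epsilon> i \<omega> = final_state j (take i l))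
    \<longleftrightarrow> (\<forall>i\<le>n. \<eta> i \<omega> = site l i \<and> \<epsilon> i \<omega> = final_state j (take i l)) \<and>
        \<eta> (Suc n) \<omega> - \<eta> n \<omega> = fst (l ! n) \<and> \<epsilon> (Suc n) \<omega> = snd (l ! n)"
    by (auto simp: le_Suc_eq s f diff_eq_eq add.commute)
  also have "\<dots> \<longleftrightarrow> \<eta> 0 \<omega> = 0 \<and> \<epsilon> 0 \<omega> = j \<and> increments (Suc n) \<omega> = take (Suc n) l"
    using Suc by (auto simp: i t prod_eq_iff)
  finally show ?case .
qed

lemma prob_trajectory:
  assumes "n \<le> length l"
  shows "prob {\<omega> \<in> space M. \<forall>i\<le>n. \<eta> i \<omega> = site l i \<and> \<epsilon> i \<omega> = final_state j (take i l)}
    = pmf initial_law j * pmf (path_pmf (step_kernel p) n j) (take n l)"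
  using assms
proof (induction n)
  case 0
  note [measurable] = measurable_state measurable_position
  have "prob {\<omega> \<in> space M. \<eta> 0 \<omega> = 0 \<and> \<epsilon> 0 \<omega> = j} = prob {\<omega> \<in> space M. \<epsilon> 0 \<omega> = j}"
    using start by (intro prob_eq_AE) auto
  then show ?case by (simp add: site_def pmf_initial_law)
next
  case (Suc n)
  note [measurable] = measurable_state measurable_position
  let ?Q = "\<lambda>n \<omega>. \<forall>i\<le>n. \<eta> i \<omega> = site l i \<and> \<epsilon> i \<omega> = final_state j (take i l)"
  have t: "take (Suc n) l = take n l @ [l ! n]" using Suc.prems by (simp add: take_Suc_conv_app_nth)
  have s: "site l (Suc n) = site l n + fst (l ! n)" by (simp add: site_def t)
  have f: "final_state j (take (Suc n) l) = snd (l ! n)" by (simp add: t)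
  have Q: "?Q (Suc n) \<omega> \<longleftrightarrow> (\<eta> (Suc n) \<omega> = site l (Suc n) \<and> \<epsilon> (Suc n) \<omega> = final_state j (take (Suc n) l)) \<and> ?Q n \<omega>" for \<omega>
    by (auto simp: le_Suc_eq)
  define a where "a = p (fst (l ! n)) (final_state j (take n l)) (snd (l ! n))"
  have "prob {\<omega> \<in> space M. ?Q (Suc n) \<omega>} = prob {\<omega> \<in> space M. ?Q n \<omega>} * a"
  proof (cases "prob {\<omega> \<in> space M. ?Q n \<omega>} = 0")
    case True
    have "prob {\<omega> \<in> space M. ?Q (Suc n) \<omega>} \<le> prob {\<omega> \<in> space M. ?Q n \<omega>}"
      by (rule finite_measure_mono) auto
    then show ?thesis using True by (simp add: measure_le_0_iff)
  next
    case False
    then have "0 < prob {\<omega> \<in> space M. ?Q n \<omega>}" by (simp add: zero_less_measure_iff)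
    from markov[OF this] show ?thesis
      using False unfolding cond_prob_def by (simp only: Q a_def s f) (simp add: field_simps)
  qed
  also have "a = pmf (step_kernel p (final_state j (take n l))) (l ! n)"
    using pmf_step_kernel[OF weights] by (metis a_def prod.collapse)
  finally show ?case using Suc by (simp add: t pmf_path_snoc del: path_pmf.simps)
qed

lemma distr_increments:
  "distr M (count_space UNIV) (increments n) = measure_pmf (walk_law initial_law (step_kernel p) n)"
proof (rule measure_eqI_countable[where A = UNIV])
  note [measurable] = measurable_state measurable_position
  let ?K = "step_kernel p"
  fix l :: "((int ^ 'd) \<times> 's) list"
  have pmf: "pmf (walk_law initial_law ?K n) l = (\<Sum>j\<in>UNIV. pmf initial_law j * pmf (path_pmf ?K n j) l)"
    unfolding walk_law_def pmf_bind by (subst integral_measure_pmf_real[of UNIV]) (auto simp: mult.commute)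
  have "prob {\<omega> \<in> space M. increments n \<omega> = l} = pmf (walk_law initial_law ?K n) l"
  proof (cases "length l = n")
    case False
    then have "l \<notin> set_pmf (walk_law initial_law ?K n)" using length_walk by blast
    moreover have "{\<omega> \<in> space M. increments n \<omega> = l} = {}" using False by auto
    ultimately show ?thesis by (simp only: measure_empty set_pmf_iff not_not)
  next
    case True
    have "{\<omega> \<in> space M. increments n \<omega> = l} = (\<Union>j\<in>UNIV. {\<omega> \<in> space M. \<epsilon> 0 \<omega> = j \<and> increments n \<omega> = l})" by auto
    then have "prob {\<omega> \<in> space M. increments n \<omega> = l} = prob (\<Union>j\<in>UNIV. {\<omega> \<in> space M. \<epsilon> 0 \<omega> = j \<and> increments n \<omega> = l})"
      by simp
    also have "\<dots> = (\<Sum>j\<in>UNIV. prob {\<omega> \<in> space M. \<epsilon> 0 \<omega> = j \<and> increments n \<omega> = l})"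
      by (rule finite_measure_finite_Union) (auto simp: disjoint_family_on_def)
    also have "\<dots> = (\<Sum>j\<in>UNIV. pmf initial_law j * pmf (path_pmf ?K n j) l)"
    proof (rule sum.cong[OF refl])
      fix j
      have "prob {\<omega> \<in> space M. \<epsilon> 0 \<omega> = j \<and> increments n \<omega> = l}
         = prob {\<omega> \<in> space M. \<forall>i\<le>n. \<eta> i \<omega> = site l i \<and> \<epsilon> i \<omega> = final_state j (take i l)}"
      proof (rule prob_eq_AE)
        show "AE \<omega> in M. (\<epsilon> 0 \<omega> = j \<and> increments n \<omega> = l) \<longleftrightarrow>
          (\<forall>i\<le>n. \<eta> i \<omega> = site l i \<and> \<epsilon> i \<omega> = final_state j (take i l))"
          using start by eventually_elim (use True trajectory_iff[of n l] in simp)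
      qed auto
      then show "prob {\<omega> \<in> space M. \<epsilon> 0 \<omega> = j \<and> increments n \<omega> = l}
        = pmf initial_law j * pmf (path_pmf ?K n j) l"
        using prob_trajectory[of n l j] True by simp
    qed
    finally show ?thesis by (simp add: pmf)
  qed
  moreover have "emeasure (distr M (count_space UNIV) (increments n)) {l} = ennreal (prob {\<omega> \<in> space M. increments n \<omega> = l})"
    by (subst emeasure_distr) (auto simp: emeasure_eq_measure vimage_def Int_def conj_commute)
  ultimately show "emeasure (distr M (count_space UNIV) (increments n)) {l}
      = emeasure (measure_pmf (walk_law initial_law ?K n)) {l}"
    by (simp add: emeasure_pmf_single)
qed (auto intro: countableI_type)

lemma expectation_increments:
  fixes f :: "_ \<Rightarrow> real"
  shows "expectation (\<lambda>\<omega>. f (increments n \<omega>)) = measure_pmf.expectation (walk_law initial_law (step_kernel p) n) f"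
  unfolding distr_increments[symmetric] by (rule integral_distr[symmetric]) auto

text \<open>
  The increments determine the visited sites up to a translation, which does not change their number.
\<close>

lemma visited_sites_increments:
  "real (visited_sites \<eta> n \<omega>) = escape_count n n (increments n \<omega>)"
proof -
  have s: "site (increments n \<omega>) i = \<eta> i \<omega> - \<eta> 0 \<omega>" if "i \<le> n" for i
    using that
  proof (induction i)
    case 0
    then show ?case by (simp add: site_def)
  next
    case (Suc i)
    then have "take (Suc i) (increments n \<omega>) = take i (increments n \<omega>) @ [(\<eta> (Suc i) \<omega> - \<eta> i \<omega>, \<epsilon> (Suc i) \<omega>)]"
      by (simp add: take_Suc_conv_app_nth increments_def)
    then show ?case using Suc by (simp add: site_def)
  qed
  have "site (increments n \<omega>) ` {..n} = (\<lambda>x. x - \<eta> 0 \<omega>) ` ((\<lambda>i. \<eta> i \<omega>) ` {0..n})"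
    unfolding image_image atLeast0AtMost using s by (intro image_cong) auto
  then have "card (site (increments n \<omega>) ` {..n}) = visited_sites \<eta> n \<omega>"
    unfolding visited_sites_def by (simp add: card_image)
  then show ?thesis using card_sites[of "increments n \<omega>" n] by simp
qed

lemma measurable_visited_sites [measurable]: "(\<lambda>\<omega>. real (visited_sites \<eta> n \<omega>)) \<in> borel_measurable M"
  unfolding visited_sites_increments by (rule measurable_compose[OF measurable_increments]) simp

lemma visited_sites_le: "visited_sites \<eta> n \<omega> \<le> n + 1"
  unfolding visited_sites_def using card_image_le[of "{0..n}" "\<lambda>i. \<eta> i \<omega>"] by simp

lemma integrable_visited_sites: "integrable M (\<lambda>\<omega>. real (visited_sites \<eta> n \<omega>))"
proof (rule integrable_const_bound[where B = "real (n + 1)"])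
  show "AE \<omega> in M. norm (real (visited_sites \<eta> n \<omega>)) \<le> real (n + 1)"
    using visited_sites_le[of n] by (intro AE_I2) (simp only: real_norm_def abs_of_nat of_nat_le_iff)
qed measurable

lemma visited_sites_Suc:
  "visited_sites \<eta> n \<omega> \<le> visited_sites \<eta> (Suc n) \<omega>"
  "visited_sites \<eta> (Suc n) \<omega> \<le> visited_sites \<eta> n \<omega> + 1"
  unfolding visited_sites_def by (auto simp: atLeastAtMostSuc_conv card_insert_if)

text \<open>
  Means with respect to the process are means over paths, so the deviation at \<open>n = k ^ 8\<close> has mean
  \<open>O(k ^ 6)\<close>, which is summable after division by \<open>n\<close>.
\<close>

lemma strong_law_visited_sites:
  assumes "transient_walk (step_kernel p) \<rho> R C"
  shows "AE \<omega> in M. (\<lambda>n. real (visited_sites \<eta> n \<omega>) / expected_visited_sites M \<eta> n) \<longlonglongrightarrow> 1"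
proof -
  interpret transient_walk initial_law "step_kernel p" \<rho> R C by (rule assms)
  define E where "E = expected_visited_sites M \<eta>"
  define f where "f k \<omega> = \<bar>real (visited_sites \<eta> (k ^ 8) \<omega>) - E (k ^ 8)\<bar> / real (k ^ 8)" for k \<omega>
  note [simp] = integrable_visited_sites
  have E: "E n = expect n (escape_count n n)" for n
    unfolding E_def expected_visited_sites_def visited_sites_increments by (rule expectation_increments)
  have f_int: "integrable M (f k)" for k unfolding f_def by simp
  have f_le: "integral\<^sup>L M (f k) \<le> (3 + 2 * R + 8 * C) * (1 / real k ^ 2)" for k
  proof (cases "k = 0")
    case True
    then show ?thesis unfolding f_def True by simp
  next
    case False
    let ?n = "k ^ 8"
    have "integral\<^sup>L M (f k) = expectation (\<lambda>\<omega>. \<bar>escape_count ?n ?n (increments ?n \<omega>) - E ?n\<bar>) / real ?n"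
      unfolding f_def visited_sites_increments by simp
    also have "\<dots> = expect ?n (\<lambda>l. \<bar>escape_count ?n ?n l - expect ?n (escape_count ?n ?n)\<bar>) / real ?n"
      by (subst expectation_increments[of "\<lambda>l. \<bar>escape_count ?n ?n l - E ?n\<bar>"]) (simp only: E)
    also have "\<dots> \<le> ((3 + 2 * R + 8 * C) * real k ^ 6) / real ?n"
      using False by (intro divide_right_mono mean_deviation_sites_eighth_power_le) auto
    also have "\<dots> = (3 + 2 * R + 8 * C) * (1 / real k ^ 2)"
    proof -
      have "real k ^ 6 * real k ^ 2 = real ?n" by (simp flip: power_add)
      then show ?thesis using False by (simp add: frac_eq_eq)
    qed
    finally show ?thesis .
  qed
  have "summable (\<lambda>k. integral\<^sup>L M (f k))"
  proof (rule summable_comparison_test')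
    show "summable (\<lambda>k. (3 + 2 * R + 8 * C) * (1 / real k ^ 2))"
      using inverse_power_summable[of 2, where 'a = real]
      by (intro summable_mult) (simp add: inverse_eq_divide power_one_over)
    show "norm (integral\<^sup>L M (f k)) \<le> (3 + 2 * R + 8 * C) * (1 / real k ^ 2)" if "0 \<le> k" for k
      using f_le[of k] by (simp add: f_def Bochner_Integration.integral_nonneg)
  qed
  then have "AE \<omega> in M. (\<lambda>k. f k \<omega>) \<longlonglongrightarrow> 0"
    by (rule AE_tendsto_0_if_summable_integrals[OF f_int, rotated]) (simp add: f_def)
  then show ?thesis
  proof eventually_elim
    case (elim \<omega>)
    show ?case
      unfolding E_def[symmetric]
    proof (rule ratio_tends_to_1_from_eighth_powers)
      show "mono (\<lambda>n. real (visited_sites \<eta> n \<omega>))"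
        unfolding mono_iff_le_Suc using visited_sites_Suc(1) by simp
      show "mono E"
        unfolding mono_iff_le_Suc E_def expected_visited_sites_def
        using visited_sites_Suc(1) by (auto intro!: integral_mono)
      show "E (Suc n) \<le> E n + 1" for n
      proof -
        have "E (Suc n) \<le> expectation (\<lambda>\<omega>. real (visited_sites \<eta> n \<omega>) + 1)"
          unfolding E_def expected_visited_sites_def
        proof (rule integral_mono)
          show "real (visited_sites \<eta> (Suc n) \<omega>) \<le> real (visited_sites \<eta> n \<omega>) + 1" for \<omega>
            using visited_sites_Suc(2)[of n \<omega>] by linarith
        qed simp_all
        also have "\<dots> = E n + 1" by (simp add: E_def expected_visited_sites_def prob_space)
        finally show ?thesis .
      qed
      show "0 < 1 / (1 + 6 * C)" using C_nonneg by simp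
      show "1 / (1 + 6 * C) * real n \<le> E n" for n
      proof -
        have "1 / (1 + 6 * C) * real n \<le> real (n + 1) / (1 + 6 * C)"
          using C_nonneg by (simp add: divide_right_mono)
        then show ?thesis using expect_sites_ge[of n] unfolding E by (simp add: add.commute)
      qed
      show "(\<lambda>k. \<bar>real (visited_sites \<eta> (k ^ 8) \<omega>) - E (k ^ 8)\<bar> / real (k ^ 8)) \<longlonglongrightarrow> 0"
        using elim by (simp add: f_def)
    qed
  qed
qed

end

theorem theorem5:
  fixes M :: "'w measure"
    and p :: "int ^ 'd::finite \<Rightarrow> 's::finite \<Rightarrow> 's \<Rightarrow> real"
    and \<eta> :: "nat \<Rightarrow> 'w \<Rightarrow> int ^ 'd"
    and \<epsilon> :: "nat \<Rightarrow> 'w \<Rightarrow> 's"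
    and \<mu> :: "real ^ 's"
  assumes "CARD('d) \<ge> 3"
    and "rwwis M p \<eta> \<epsilon>"
    and "basic_assumptions p \<mu>"
  shows "\<P>(\<omega> in M. (\<lambda>n. real (visited_sites \<eta> n \<omega>) / expected_visited_sites M \<eta> n)
           \<longlonglongrightarrow> 1) = 1"
proof -
  interpret rwwis M p \<eta> \<epsilon> by (rule assms(2))
  from assms(3) have "irreducible_matrix (rw_Q p)" "aperiodic_matrix (rw_Q p)" "trivial_arithmetic p"
    by (simp_all add: basic_assumptions_def)
  then obtain \<rho> R C where tw: "transient_walk (step_kernel p) \<rho> R C"
    using transient_walk_step_kernel[OF assms(1) weights] by blast
  show ?thesis
    by (subst prob_Collect_eq_1) (measurable, rule strong_law_visited_sites[OF tw])
qed

end
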